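(* Let $Y=\{y_k\}_{k\ge1}$, let ш and $*_{\mathrm{st}}$ denote the shuffle and stuffle (quasi-shuffle) products, and let $\ell_r$, $\Gamma_{y_r}$, the character $\gamma_\bullet$ (extended to series) and the map $\alpha_0^z$ (for the differential forms $\{(\partial\ell_r)dz\}_{r\ge1}$) be as in the context. (1) For every $z\in\mathbb{C}$ with $|z|<1$, one has $$\gamma_{\,*_{\mathrm{st}\,r\ge1}(z^ry_r)^*}=\prod_{r\ge1}\gamma_{(z^ry_r)^*}=\prod_{r\ge1}e^{\ell_r(z)}=\prod_{r\ge1}\frac{1}{\Gamma_{y_r}(1+z)}=\alpha_0^z\bigl(\text{ш}_{r\ge1}\,y_r^*\bigr),$$ where $*_{\mathrm{st}\,r\ge1}$ and $\text{ш}_{r\ge1}$ denote the stuffle, respectively shuffle, product over all $r\ge1$. (2) For complex families $(a_s)_{s\ge1},(b_s)_{s\ge1}$ with $|a_s|<1$, $|b_s|<1$ and $|a_s+b_s|<1$ (the series involved being in the domain of $\gamma_\bullet$), one has $$\gamma_{(\sum_{s\ge1}(a_s+b_s)y_s+\sum_{r,s\ge1}a_sb_ry_{s+r})^*}=\gamma_{(\sum_{s\ge1}a_sy_s)^*}\,\gamma_{(\sum_{s\ge1}b_sy_s)^*}.$$ Hence (for $r,s\ge1$), $\gamma_{(a_sy_s+a_ry_r+a_sa_ry_{s+r})^*}=\gamma_{(a_sy_s)^*}\gamma_{(a_ry_r)^*}$ and $\gamma_{(-a_s^2y_{2s})^*}=\gamma_{(a_sy_s)^*}\gamma_{(-a_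sy_s)^*}$.
   Context: With $\zeta$ the Riemann zeta function and $\gamma$ Euler's constant, for $|z|<1$ put $\ell_1(z):=\gamma z-\sum_{k\ge2}\zeta(k)\frac{(-z)^k}{k}$, $\ell_r(z):=-\sum_{k\ge1}\zeta(kr)\frac{(-z^r)^k}{k}$ for $r\ge2$, and $\Gamma_{y_r}(1+z):=e^{-\ell_r(z)}$. The stuffle product on words over $Y$ is defined by $1*_{\mathrm{st}}w=w*_{\mathrm{st}}1=w$ and $y_iu*_{\mathrm{st}}y_jv=y_i(u*_{\mathrm{st}}y_jv)+y_j(y_iu*_{\mathrm{st}}v)+y_{i+j}(u*_{\mathrm{st}}v)$. $S^*=\sum_{n\ge0}S^n$ (concatenation powers) is the Kleene star of a series with zero constant term. Order $y_1>y_2>\cdots$; the Lyndon words over $Y$ freely generate the stuffle algebra $(\mathbb{C}\langle Y\rangle,*_{\mathrm{st}})$, and $\gamma_\bullet$ is its character with $\gamma_{y_1}=\gamma$ and $\gamma_{l}=\sum_{n_1>\cdots>n_m>0}n_1^{-s_1}\cdots n_m^{-s_m}$ for each Lyndon word $l=y_{s_1}\cdots y_{s_m}\ne y_1$. It is extended to series $S=\sum_nS_n$, $S_n=\sum_{|w|=n}\langle S|w\rangle w$, by $\gamma_S=\sum_n\gamma_{S_n}$ whenever this converges (the domain of $\gamma_\bullet$), and satisfies $\gamma_{(t^ry_r)^*}=\Gamma_{y_r}^{-1}(1+t)$ (reciprocal) for $|t|<1$. With $\partial=d/dz$ and $\omega_r=(\partial\ell_r)dz$, $\alpha_0^z$ is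 the map given on words by $\alpha_0^z(1_{Y^*})=1$ and $\alpha_0^z(y_{i_1}\cdots y_{i_k})=\int_0^z\omega_{i_1}(z_1)\int_0^{z_1}\omega_{i_2}(z_2)\cdots\int_0^{z_{k-1}}\omega_{i_k}(z_k)$, extended linearly to series; it is a morphism for the shuffle product. *)

theory Defs
  imports
    "HOL-Complex_Analysis.Complex_Analysis"
    "HOL-Library.Multiset"
    "HOL-Library.Function_Algebras"
begin

section \<open>Words and noncommutative series over \<open>Y = {y\<^sub>k}\<close>, \<open>k \<ge> 1\<close>\<close>

text \<open>The letter \<open>y\<^sub>k\<close> is represented by the number \<open>k\<close>, and a word by a list, so that \<open>Y\<^sup>*\<close> consists
  of the lists in which \<open>0\<close> does not occur. A series is its family of coefficients. Addition of
  series is the pointwise one; the pointwise \<open>0\<close>, \<open>1\<close> and product of functions are not used.\<close>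

type_synonym word = "nat list"
type_synonym series = "word \<Rightarrow> complex"

definition Y_words :: "word set" where
  "Y_words = {w. 0 \<notin> set w}"

definition one_series :: series where
  "one_series w = (if w = [] then 1 else 0)"

definition yterm :: "complex \<Rightarrow> nat \<Rightarrow> series" where
  \<comment> \<open>the series \<open>c y\<^sub>s\<close>\<close>
  "yterm c s = (\<lambda>w. if w = [s] then c else 0)"

definition series_sum :: "'i set \<Rightarrow> ('i \<Rightarrow> series) \<Rightarrow> series" where
  \<comment> \<open>sum of a locally finite family: for each word, only finitely many members of the family have
    a nonzero coefficient\<close>
  "series_sum I F = (\<lambda>w. \<Sum>i | i \<in> I \<and> F i w \<noteq> 0. F i w)"

definition conc :: "series \<Rightarrow> series \<Rightarrow> series" where
  "conc S T = (\<lambda>w. \<Sum>i\<le>length w. S (take i w) * T (drop i w))"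

primrec conc_power :: "series \<Rightarrow> nat \<Rightarrow> series" where
  "conc_power S 0 = one_series"
| "conc_power S (Suc n) = conc S (conc_power S n)"

definition kleene_star :: "series \<Rightarrow> series" where
  \<comment> \<open>meaningful for series with zero constant term\<close>
  "kleene_star S = series_sum UNIV (conc_power S)"


section \<open>Shuffle and stuffle products\<close>

text \<open>The product of two words is a polynomial with coefficients in the natural numbers, represented
  by a multiset of words.\<close>

fun shuffle :: "word \<Rightarrow> word \<Rightarrow> word multiset" where
  "shuffle [] w = {#w#}"
| "shuffle w [] = {#w#}"
| "shuffle (i # u) (j # v) =
     image_mset ((#) i) (shuffle u (j # v)) + image_mset ((#) j) (shuffle (i # u) v)"

fun stuffle :: "word \<Rightarrow> word \<Rightarrow> word multiset" where
  "stuffle [] w = {#w#}"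
| "stuffle w [] = {#w#}"
| "stuffle (i # u) (j # v) =
     image_mset ((#) i) (stuffle u (j # v)) + image_mset ((#) j) (stuffle (i # u) v)
     + image_mset ((#) (i + j)) (stuffle u v)"

text \<open>Bilinear extension to series of a product \<open>m\<close> of words. For both products above, a word occurs
  in \<open>m u v\<close> for finitely many pairs \<open>(u, v)\<close> only.\<close>

definition series_prod :: "(word \<Rightarrow> word \<Rightarrow> word multiset) \<Rightarrow> series \<Rightarrow> series \<Rightarrow> series" where
  "series_prod m S T =
     (\<lambda>w. \<Sum>(u, v) | w \<in># m u v. of_nat (count (m u v) w) * S u * T v)"

primrec series_prod_upto :: "(word \<Rightarrow> word \<Rightarrow> word multiset) \<Rightarrow> (nat \<Rightarrow> series) \<Rightarrow> nat \<Rightarrow> series" where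
  \<comment> \<open>product of \<open>F 1, \<dots>, F N\<close>\<close>
  "series_prod_upto m F 0 = one_series"
| "series_prod_upto m F (Suc N) = series_prod m (series_prod_upto m F N) (F (Suc N))"

definition series_prod_inf :: "(word \<Rightarrow> word \<Rightarrow> word multiset) \<Rightarrow> (nat \<Rightarrow> series) \<Rightarrow> series" where
  \<comment> \<open>product over all \<open>r \<ge> 1\<close>, as the coefficientwise limit of the finite products\<close>
  "series_prod_inf m F = (\<lambda>w. lim (\<lambda>N. series_prod_upto m F N w))"


section \<open>The character \<open>\<gamma>\<^sub>\<bullet>\<close> of the stuffle algebra\<close>

definition lyndon :: "word \<Rightarrow> bool" where
  \<comment> \<open>nonempty words over \<open>Y\<close> smaller than all their proper nonempty suffixes, for the
    lexicographic order induced by \<open>y\<^sub>1 > y\<^sub>2 > \<dots>\<close>\<close>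
  "lyndon l \<longleftrightarrow> l \<in> Y_words \<and> l \<noteq> [] \<and>
     (\<forall>u v. l = u @ v \<longrightarrow> u \<noteq> [] \<longrightarrow> v \<noteq> [] \<longrightarrow> (l, v) \<in> lexord {(i, j). i > j})"

definition polyzeta :: "word \<Rightarrow> complex" where
  \<comment> \<open>the sum over \<open>n\<^sub>1 > \<dots> > n\<^sub>m > 0\<close>\<close>
  "polyzeta s =
     (\<Sum>\<^sub>\<infinity>n \<in> {n :: nat list. length n = length s \<and> sorted_wrt (>) n \<and> 0 \<notin> set n}.
        \<Prod>i<length s. 1 / of_nat (n ! i) ^ (s ! i))"

text \<open>A character of the stuffle algebra is given by its values on words. As the Lyndon words freely
  generate this algebra, the following conditions determine exactly one family of values on \<open>Y\<^sup>*\<close>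
  (the values on lists outside of \<open>Y\<^sup>*\<close> are irrelevant).\<close>

definition gamma_character :: "(word \<Rightarrow> complex) \<Rightarrow> bool" where
  "gamma_character \<phi> \<longleftrightarrow>
     \<phi> [] = 1 \<and>
     (\<forall>u\<in>Y_words. \<forall>v\<in>Y_words. (\<Sum>w\<in>#stuffle u v. \<phi> w) = \<phi> u * \<phi> v) \<and>
     \<phi> [1] = euler_mascheroni \<and>
     (\<forall>l. lyndon l \<longrightarrow> l \<noteq> [1] \<longrightarrow> \<phi> l = polyzeta l)"

text \<open>Extension to series. The homogeneous component \<open>S\<^sub>n\<close> is taken with respect to the weight
  \<open>s\<^sub>1 + \<dots> + s\<^sub>m\<close> of \<open>y\<^bsub>s\<^sub>1\<^esub> \<dots> y\<^bsub>s\<^sub>m\<^esub>\<close>, for which the stuffle algebra is graded: there are finitely many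
  words of weight \<open>n\<close>, so that \<open>S\<^sub>n\<close> is a polynomial, on which the character is defined. (The
  components with respect to the number of letters are in general not polynomials.)\<close>

definition gamma_comp :: "(word \<Rightarrow> complex) \<Rightarrow> series \<Rightarrow> nat \<Rightarrow> complex" where
  "gamma_comp \<phi> S n = (\<Sum>w | w \<in> Y_words \<and> sum_list w = n. S w * \<phi> w)"

definition gamma_dom :: "(word \<Rightarrow> complex) \<Rightarrow> series \<Rightarrow> bool" where
  "gamma_dom \<phi> S \<longleftrightarrow> summable (gamma_comp \<phi> S)"

definition gamma_ext :: "(word \<Rightarrow> complex) \<Rightarrow> series \<Rightarrow> complex" where
  "gamma_ext \<phi> S = (\<Sum>n. gamma_comp \<phi> S n)"


section \<open>The functions \<open>\<ell>\<^sub>r\<close>, \<open>\<Gamma>\<close> and the map \<open>\<alpha>\<close>\<close>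

definition zeta :: "nat \<Rightarrow> complex" where
  \<comment> \<open>the Riemann zeta function, only needed at the integers \<open>k \<ge> 2\<close>\<close>
  "zeta k = (\<Sum>n. 1 / of_nat (Suc n) ^ k)"

definition ell :: "nat \<Rightarrow> complex \<Rightarrow> complex" where
  "ell r z =
     (if r = 1 then euler_mascheroni * z - (\<Sum>k. zeta (k + 2) * (- z) ^ (k + 2) / of_nat (k + 2))
      else - (\<Sum>k. zeta (Suc k * r) * (- (z ^ r)) ^ Suc k / of_nat (Suc k)))"

definition Gamma_Y :: "nat \<Rightarrow> complex \<Rightarrow> complex" where
  \<comment> \<open>so that \<open>Gamma_Y r (1 + z) = exp (- ell r z)\<close>\<close>
  "Gamma_Y r x = exp (- ell r (x - 1))"

text \<open>The forms \<open>\<omega>\<^sub>r = (\<partial> \<ell>\<^sub>r) dz\<close> are holomorphic in the unit disc, hence the iterated integrals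
  can be taken along straight segments.\<close>

primrec alpha :: "word \<Rightarrow> complex \<Rightarrow> complex" where
  "alpha [] z = 1"
| "alpha (i # w) z = contour_integral (linepath 0 z) (\<lambda>t. deriv (ell i) t * alpha w t)"

definition alpha_dom :: "complex \<Rightarrow> series \<Rightarrow> bool" where
  "alpha_dom z S \<longleftrightarrow> (\<lambda>w. S w * alpha w z) summable_on Y_words"

definition alpha_ext :: "complex \<Rightarrow> series \<Rightarrow> complex" where
  "alpha_ext z S = (\<Sum>\<^sub>\<infinity>w\<in>Y_words. S w * alpha w z)"

end

theory Submission
  imports Defs
begin

text \<open>Dually to the recursion for the stuffle of words, the coefficients of a product of two series at
  \<open>y\<^sub>k w\<close> are obtained from products of the left quotients of the factors. It follows
  that the Kleene stars of combinations \<open>\<Sum> a\<^sub>s y\<^sub>s\<close> of letters multiply like the power series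
  \<open>1 + \<Sum> a\<^sub>s x\<^sup>s\<close>. As the stuffle product is graded by the weight, a character turns
  it into a Cauchy product of weight components, and part (2) becomes Abel's theorem on Cauchy products
  of convergent series. Newton's identities for the words \<open>y\<^sub>r\<^sup>n\<close> say that the generating series of
  their values solves the differential equation of \<open>exp \<circ> \<ell>\<^sub>r\<close>. The infinite stuffle product is
  handled by locally uniform convergence of \<open>\<Prod> exp (\<ell>\<^sub>r z)\<close>. The infinite shuffle product is the sum
  of all words, and the iterated integrals over words of length \<open>n\<close> add up to
  \<open>(\<Sum> \<ell>\<^sub>r z)\<^sup>n / n!\<close>.\<close>

section \<open>Stars of letter series and their products\<close>

text \<open>Convergence shapes the argument in two ways. In part (2) the weight series are only
  assumed to converge, possibly conditionally, so the theorem on products of absolutely convergent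
  series does not apply; Abel means restore absolute convergence and the limit is taken afterwards.
  In part (1) all estimates come from one uniform bound on the values at single letters, Euler's
  constant plus zeta(2). It makes \<open>ell r z\<close> of size O(|z|^r) on every smaller disc,
  hence the sum over \<open>r\<close> converges uniformly there, and Cauchy's inequality yields a
  summable bound for the derivatives inside the iterated integrals. The infinite stuffle product is
  within reach because the coefficient \<open>z ^ r\<close> of \<open>y_r\<close> matches its
  weight: a component of weight \<open>n\<close> is a constant times \<open>z ^ n\<close>. Its
  \<open>gamma_ext\<close> is therefore a power series in \<open>z\<close>, to be compared
  coefficientwise with a Taylor series.\<close>

definition letter_series :: "(nat \<Rightarrow> complex) \<Rightarrow> series" where
  "letter_series c w = (if length w = 1 then c (hd w) else 0)"

text \<open>This is the Kleene star of \<open>letter_series c\<close>. It is multiplicative for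
  concatenation, so its left quotient by the letter \<open>k\<close> is \<open>c k\<close> times
  itself, which closes the recursions for products of such stars.\<close>

definition star :: "(nat \<Rightarrow> complex) \<Rightarrow> series" where
  "star c w = prod_list (map c w)"

lemma star_simps [simp]: "star c [] = 1" "star c (k # w) = c k * star c w"
  by (simp_all add: star_def)

lemma conc_power_letter_series:
  "conc_power (letter_series c) n w = (if length w = n then star c w else 0)"
proof (induction n arbitrary: w)
  case 0
  then show ?case by (auto simp: one_series_def)
next
  case (Suc n)
  show ?case
  proof (cases w)
    case Nil
    then show ?thesis by (simp add: conc_def letter_series_def)
  next
    case (Cons k u)
    have "conc (letter_series c) (conc_power (letter_series c) n) w
        = (\<Sum>i\<in>{1}. letter_series c (take i w) * conc_power (letter_series c) n (drop i w))"
      unfolding conc_def by (rule sum.mono_neutral_right) (auto simp: Cons letter_series_def)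
    also have "\<dots> = c k * conc_power (letter_series c) n u"
      by (simp add: Cons letter_series_def)
    finally show ?thesis
      by (simp add: Suc.IH Cons)
  qed
qed

lemma kleene_star_letter_series: "kleene_star (letter_series c) = star c"
proof
  fix w
  have "kleene_star (letter_series c) w = (\<Sum>n\<in>{length w}. conc_power (letter_series c) n w)"
    unfolding kleene_star_def series_sum_def
    by (rule sum.mono_neutral_left) (auto simp: conc_power_letter_series)
  then show "kleene_star (letter_series c) w = star c w"
    by (simp add: conc_power_letter_series)
qed

lemma yterm_eq_letter_series: "yterm c s = letter_series (\<lambda>k. if k = s then c else 0)"
  by (auto simp: fun_eq_iff yterm_def letter_series_def length_Suc_conv)

lemma letter_series_add:
  "letter_series c + letter_series d = letter_series (\<lambda>k. c k + d k)"
  by (auto simp: fun_eq_iff letter_series_def)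

lemma series_sum_yterm:
  "series_sum {1..} (\<lambda>s. yterm (a s) s) = letter_series (\<lambda>k. if k \<ge> 1 then a k else 0)"
proof
  fix w :: word
  show "series_sum {1..} (\<lambda>s. yterm (a s) s) w = letter_series (\<lambda>k. if k \<ge> 1 then a k else 0) w"
  proof (cases "length w = 1")
    case True
    then obtain k where w: "w = [k]" by (auto simp: length_Suc_conv)
    have "series_sum {1..} (\<lambda>s. yterm (a s) s) w = (\<Sum>s\<in>{1..} \<inter> {k}. yterm (a s) s w)"
      unfolding series_sum_def by (rule sum.mono_neutral_left) (auto simp: yterm_def w)
    then show ?thesis by (auto simp: w yterm_def letter_series_def Int_insert_right)
  next
    case False
    then have "yterm (a s) s w = 0" for s by (auto simp: yterm_def)
    then show ?thesis using False by (simp add: series_sum_def letter_series_def)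
  qed
qed

lemma series_sum_yterm_pairs:
  "series_sum ({1..} \<times> {1..}) (\<lambda>(r, s). yterm (a s * b r) (s + r))
     = letter_series (\<lambda>k. \<Sum>s\<in>{1..<k}. a s * b (k - s))"
proof
  fix w :: word
  let ?S = "series_sum ({1..} \<times> {1..}) (\<lambda>(r, s). yterm (a s * b r) (s + r))"
  show "?S w = letter_series (\<lambda>k. \<Sum>s\<in>{1..<k}. a s * b (k - s)) w"
  proof (cases "length w = 1")
    case True
    then obtain k where w: "w = [k]" by (auto simp: length_Suc_conv)
    \<comment> \<open>The pairs contributing to the letter \<open>k\<close> are those with
      \<open>r + s = k\<close>; both entries are positive, so \<open>s < k\<close> lists them
      all.\<close>
    let ?f = "\<lambda>s. (k - s, s)"
    have "?S w = (\<Sum>(r, s)\<in>?f ` {1..<k}. yterm (a s * b r) (s + r) w)"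
      unfolding series_sum_def
    proof (rule sum.mono_neutral_cong_left)
      show "{i \<in> {1..} \<times> {1..}. (case i of (r, s) \<Rightarrow> yterm (a s * b r) (s + r)) w \<noteq> 0}
          \<subseteq> ?f ` {1..<k}"
        by (auto simp: w yterm_def image_iff split: if_splits)
    qed (auto simp: w)
    also have "\<dots> = (\<Sum>s\<in>{1..<k}. a s * b (k - s))"
      by (subst sum.reindex) (auto simp: inj_on_def yterm_def w intro!: sum.cong)
    finally show ?thesis by (simp add: w letter_series_def)
  next
    case False
    then have "yterm c s w = 0" for c s by (auto simp: yterm_def)
    then show ?thesis using False by (simp add: series_sum_def letter_series_def case_prod_unfold)
  qed
qed

text \<open>A finite set of words carrying every factorisation of the words of bounded length and weight,
  which replaces the index set of \<^const>\<open>series_prod\<close>.\<close>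

definition word_box :: "nat \<Rightarrow> nat \<Rightarrow> word set" where
  "word_box n m = {w. set w \<subseteq> {..m} \<and> length w \<le> n}"

lemma finite_word_box [simp]: "finite (word_box n m)"
  by (simp add: word_box_def finite_lists_length_le)

lemma word_box_0 [simp]: "word_box 0 m = {[]}"
  by (auto simp: word_box_def)

lemma word_box_Suc: "word_box (Suc n) m = insert [] ((\<lambda>(k, u). k # u) ` ({..m} \<times> word_box n m))"
proof (intro set_eqI)
  fix w show "w \<in> word_box (Suc n) m \<longleftrightarrow> w \<in> insert [] ((\<lambda>(k, u). k # u) ` ({..m} \<times> word_box n m))"
    by (cases w) (auto simp: word_box_def image_iff)
qed

text \<open>Left quotient of a word, with default 0 when \<open>u\<close> does not start with
  \<open>k\<close>. It lets multiplicities in a product be written without case distinctions on the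
  factors.\<close>

definition word_factor :: "nat \<Rightarrow> word \<Rightarrow> (word \<Rightarrow> nat) \<Rightarrow> nat" where
  "word_factor k u f = (if u \<noteq> [] \<and> hd u = k then f (tl u) else 0)"

lemma word_factor_simps [simp]: "word_factor k [] f = 0"
  "word_factor k (i # u) f = (if i = k then f u else 0)"
  by (simp_all add: word_factor_def)

text \<open>Adjointness: summation moves the left quotient from the word to the series. The box
  loses one unit of length because the first letter is stripped.\<close>

lemma sum_word_factor:
  fixes S :: series
  assumes "k \<le> m"
  shows "(\<Sum>u\<in>word_box (Suc n) m. of_nat (word_factor k u f) * S u)
       = (\<Sum>u\<in>word_box n m. of_nat (f u) * S (k # u))"
proof -
  have "(\<Sum>u\<in>word_box (Suc n) m. of_nat (word_factor k u f) * S u)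
      = (\<Sum>u\<in>(#) k ` word_box n m. of_nat (word_factor k u f) * S u)"
  proof (rule sum.mono_neutral_right)
    show "(#) k ` word_box n m \<subseteq> word_box (Suc n) m"
      using assms by (auto simp: word_box_def)
    show "\<forall>u\<in>word_box (Suc n) m - (#) k ` word_box n m. of_nat (word_factor k u f) * S u = 0"
      by (auto simp: word_box_Suc)
  qed simp
  then show ?thesis by (simp add: sum.reindex)
qed

section \<open>Finiteness and first-letter recursions of the word products\<close>

text \<open>The property shared by shuffle and stuffle that confines all factors of a given word to
  one \<open>word_box\<close>, so that both products can be treated at once.\<close>

definition factors_below :: "(word \<Rightarrow> word \<Rightarrow> word multiset) \<Rightarrow> bool" where
  "factors_below p \<longleftrightarrow> (\<forall>u v w. w \<in># p u v \<longrightarrow>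
     length u \<le> length w \<and> length v \<le> length w \<and> sum_list w = sum_list u + sum_list v)"

lemma factors_below_stuffle: "factors_below stuffle"
proof -
  have "w \<in># stuffle u v \<Longrightarrow>
     length u \<le> length w \<and> length v \<le> length w \<and> sum_list w = sum_list u + sum_list v" for u v w
    by (induction u v arbitrary: w rule: stuffle.induct) force+
  then show ?thesis by (simp add: factors_below_def)
qed

lemma factors_below_shuffle: "factors_below shuffle"
proof -
  have "w \<in># shuffle u v \<Longrightarrow>
     length u \<le> length w \<and> length v \<le> length w \<and> sum_list w = sum_list u + sum_list v" for u v w
    by (induction u v arbitrary: w rule: shuffle.induct) force+
  then show ?thesis by (simp add: factors_below_def)
qed

lemma factors_below_word_box:
  assumes "factors_below p" "w \<in># p u v" "length w \<le> n" "sum_list w \<le> m"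
  shows "u \<in> word_box n m" "v \<in> word_box n m"
proof -
  have "length u \<le> n" "length v \<le> n" "sum_list u \<le> m" "sum_list v \<le> m"
    using assms unfolding factors_below_def by fastforce+
  then show "u \<in> word_box n m" "v \<in> word_box n m"
    by (auto simp: word_box_def dest: member_le_sum_list)
qed

lemma series_prod_word_box:
  assumes "factors_below p" "length w \<le> n" "sum_list w \<le> m"
  shows "series_prod p S T w
       = (\<Sum>u\<in>word_box n m. \<Sum>v\<in>word_box n m. of_nat (count (p u v) w) * S u * T v)"
proof -
  have "series_prod p S T w
      = (\<Sum>(u, v)\<in>word_box n m \<times> word_box n m. of_nat (count (p u v) w) * S u * T v)"
    unfolding series_prod_def
    by (rule sum.mono_neutral_left)
       (auto dest: factors_below_word_box[OF assms(1) _ assms(2,3)] simp: not_in_iff)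
  then show ?thesis by (simp add: sum.cartesian_product)
qed

lemma count_image_Cons: "count (image_mset ((#) i) M) (k # w) = (if i = k then count M w else 0)"
proof (cases "i = k")
  case True
  have "count (image_mset ((#) k) M) (k # w) = count M w"
    by (induction M) auto
  then show ?thesis using True by simp
next
  case False
  then show ?thesis by (auto simp: count_eq_zero_iff)
qed

lemma stuffle_Nil_right [simp]: "stuffle u [] = {#u#}"
  by (cases u) simp_all

lemma shuffle_Nil_right [simp]: "shuffle u [] = {#u#}"
  by (cases u) simp_all

text \<open>The leading letter \<open>k\<close> comes from \<open>u\<close>, from \<open>v\<close>,
  or from merging the two leading letters. In the last sum at most the index \<open>i = hd u\<close>
  contributes.\<close>

lemma count_stuffle_Cons:
  "count (stuffle u v) (k # w) = word_factor k u (\<lambda>u'. count (stuffle u' v) w)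
     + word_factor k v (\<lambda>v'. count (stuffle u v') w)
     + (\<Sum>i\<le>k. word_factor i u (\<lambda>u'. word_factor (k - i) v (\<lambda>v'. count (stuffle u' v') w)))"
proof (cases u)
  case Nil
  then show ?thesis by (cases v) auto
next
  case u: (Cons i u')
  show ?thesis
  proof (cases v)
    case Nil
    then show ?thesis using u by (auto split: list.splits)
  next
    case v: (Cons j v')
    have "(\<Sum>l\<le>k. word_factor l u (\<lambda>u'. word_factor (k - l) v (\<lambda>v'. count (stuffle u' v') w)))
        = (if i + j = k then count (stuffle u' v') w else 0)"
    proof -
      have "(\<Sum>l\<le>k. word_factor l u (\<lambda>u'. word_factor (k - l) v (\<lambda>v'. count (stuffle u' v') w)))
          = (\<Sum>l\<le>k. if l = i then (if j = k - i then count (stuffle u' v') w else 0) else 0)"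
        by (intro sum.cong) (auto simp: u v)
      then show ?thesis by (auto simp: sum.delta)
    qed
    then show ?thesis by (simp add: u v count_image_Cons)
  qed
qed

lemma count_shuffle_Cons:
  "count (shuffle u v) (k # w) = word_factor k u (\<lambda>u'. count (shuffle u' v) w)
     + word_factor k v (\<lambda>v'. count (shuffle u v') w)"
  by (cases u; cases v) (auto simp: count_image_Cons)

lemma count_stuffle_Nil: "count (stuffle u v) [] = (if u = [] \<and> v = [] then 1 else 0)"
  by (cases u; cases v) (auto simp: count_eq_zero_iff)

lemma count_shuffle_Nil: "count (shuffle u v) [] = (if u = [] \<and> v = [] then 1 else 0)"
  by (cases u; cases v) (auto simp: count_eq_zero_iff)

lemma series_prod_stuffle_Nil: "series_prod stuffle S T [] = S [] * T []"
  by (subst series_prod_word_box[OF factors_below_stuffle, of _ 0 0])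
     (simp_all add: count_stuffle_Nil)

lemma series_prod_shuffle_Nil: "series_prod shuffle S T [] = S [] * T []"
  by (subst series_prod_word_box[OF factors_below_shuffle, of _ 0 0])
     (simp_all add: count_shuffle_Nil)

text \<open>After the left quotient has moved to \<open>S\<close>, the box for \<open>u\<close> is
  one unit too short. It may be enlarged again because a word longer than \<open>n\<close> cannot be
  a factor of \<open>w\<close>.\<close>

lemma series_prod_left_factor:
  assumes "factors_below p" "length w \<le> n" "k + sum_list w \<le> m"
  shows "(\<Sum>u\<in>word_box (Suc n) m. \<Sum>v\<in>word_box (Suc n) m.
           of_nat (word_factor k u (\<lambda>u'. count (p u' v) w)) * S u * T v)
       = series_prod p (\<lambda>u. S (k # u)) T w"
proof -
  have "(\<Sum>u\<in>word_box (Suc n) m. \<Sum>v\<in>word_box (Suc n) m.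
           of_nat (word_factor k u (\<lambda>u'. count (p u' v) w)) * S u * T v)
      = (\<Sum>v\<in>word_box (Suc n) m. (\<Sum>u\<in>word_box (Suc n) m.
           of_nat (word_factor k u (\<lambda>u'. count (p u' v) w)) * S u) * T v)"
    by (subst sum.swap) (simp add: sum_distrib_right)
  also have "\<dots> = (\<Sum>v\<in>word_box (Suc n) m. \<Sum>u\<in>word_box n m. of_nat (count (p u v) w) * S (k # u) * T v)"
    using assms(3) by (simp add: sum_word_factor sum_distrib_right)
  also have "\<dots> = (\<Sum>u\<in>word_box n m. \<Sum>v\<in>word_box (Suc n) m. of_nat (count (p u v) w) * S (k # u) * T v)"
    by (rule sum.swap)
  also have "\<dots> = (\<Sum>u\<in>word_box (Suc n) m. \<Sum>v\<in>word_box (Suc n) m. of_nat (count (p u v) w) * S (k # u) * T v)"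
  proof (rule sum.mono_neutral_left)
    show "word_box n m \<subseteq> word_box (Suc n) m" by (auto simp: word_box_def)
    show "\<forall>u\<in>word_box (Suc n) m - word_box n m.
        (\<Sum>v\<in>word_box (Suc n) m. of_nat (count (p u v) w) * S (k # u) * T v) = 0"
    proof
      fix u assume "u \<in> word_box (Suc n) m - word_box n m"
      then have "w \<notin># p u v" for v
        using factors_below_word_box(1)[OF assms(1) _ assms(2), of u v m] assms(3) by auto
      then show "(\<Sum>v\<in>word_box (Suc n) m. of_nat (count (p u v) w) * S (k # u) * T v) = 0"
        by (simp add: not_in_iff)
    qed
  qed simp
  also have "\<dots> = series_prod p (\<lambda>u. S (k # u)) T w"
    using assms by (subst series_prod_word_box[of p w "Suc n" m]) auto
  finally show ?thesis .
qed

lemma series_prod_right_factor: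
  assumes "factors_below p" "length w \<le> n" "k + sum_list w \<le> m"
  shows "(\<Sum>u\<in>word_box (Suc n) m. \<Sum>v\<in>word_box (Suc n) m.
           of_nat (word_factor k v (\<lambda>v'. count (p u v') w)) * S u * T v)
       = series_prod p S (\<lambda>v. T (k # v)) w"
proof -
  \<comment> \<open>Passing to the opposite product reduces the claim to the left factor.\<close>
  let ?q = "\<lambda>u v. p v u"
  have q: "factors_below ?q" using assms(1) by (auto simp: factors_below_def)
  have swap: "series_prod ?q A B w = series_prod p B A w" for A B
    using assms
    by (subst (1 2) series_prod_word_box[of _ w n m]; simp add: q)
       (subst sum.swap, simp add: mult_ac)
  have "(\<Sum>u\<in>word_box (Suc n) m. \<Sum>v\<in>word_box (Suc n) m.
           of_nat (word_factor k v (\<lambda>v'. count (p u v') w)) * S u * T v)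
      = (\<Sum>v\<in>word_box (Suc n) m. \<Sum>u\<in>word_box (Suc n) m.
           of_nat (word_factor k v (\<lambda>v'. count (?q v' u) w)) * T v * S u)"
    by (subst sum.swap) (simp add: mult_ac)
  then show ?thesis
    by (simp only: series_prod_left_factor[OF q assms(2,3)] swap)
qed

lemma series_prod_both_factor:
  assumes "factors_below p" "length w \<le> n" "i + j + sum_list w \<le> m"
  shows "(\<Sum>u\<in>word_box (Suc n) m. \<Sum>v\<in>word_box (Suc n) m.
           of_nat (word_factor i u (\<lambda>u'. word_factor j v (\<lambda>v'. count (p u' v') w))) * S u * T v)
       = series_prod p (\<lambda>u. S (i # u)) (\<lambda>v. T (j # v)) w"
proof -
  have "(\<Sum>u\<in>word_box (Suc n) m. \<Sum>v\<in>word_box (Suc n) m.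
           of_nat (word_factor i u (\<lambda>u'. word_factor j v (\<lambda>v'. count (p u' v') w))) * S u * T v)
      = (\<Sum>v\<in>word_box (Suc n) m. (\<Sum>u\<in>word_box (Suc n) m.
           of_nat (word_factor i u (\<lambda>u'. word_factor j v (\<lambda>v'. count (p u' v') w))) * S u) * T v)"
    by (subst sum.swap) (simp add: sum_distrib_right)
  also have "\<dots> = (\<Sum>v\<in>word_box (Suc n) m. \<Sum>u\<in>word_box n m.
           of_nat (word_factor j v (\<lambda>v'. count (p u v') w)) * S (i # u) * T v)"
    using assms(3) by (simp add: sum_word_factor sum_distrib_right)
  also have "\<dots> = (\<Sum>u\<in>word_box n m. (\<Sum>v\<in>word_box (Suc n) m.
           of_nat (word_factor j v (\<lambda>v'. count (p u v') w)) * T v) * S (i # u))"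
    by (subst sum.swap) (simp add: sum_distrib_right sum_distrib_left mult_ac)
  also have "\<dots> = (\<Sum>u\<in>word_box n m. (\<Sum>v\<in>word_box n m. of_nat (count (p u v) w) * T (j # v)) * S (i # u))"
    using assms(3) by (simp add: sum_word_factor)
  also have "\<dots> = series_prod p (\<lambda>u. S (i # u)) (\<lambda>v. T (j # v)) w"
    using assms by (subst series_prod_word_box[of p w n m]) (simp_all add: sum_distrib_left sum_distrib_right mult_ac)
  finally show ?thesis .
qed

lemma series_prod_stuffle_Cons:
  "series_prod stuffle S T (k # w) = series_prod stuffle (\<lambda>u. S (k # u)) T w
     + series_prod stuffle S (\<lambda>v. T (k # v)) w
     + (\<Sum>i\<le>k. series_prod stuffle (\<lambda>u. S (i # u)) (\<lambda>v. T ((k - i) # v)) w)"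
proof -
  define n m where "n = length w" and "m = k + sum_list w"
  let ?B = "word_box (Suc n) m"
  have "series_prod stuffle S T (k # w)
      = (\<Sum>u\<in>?B. \<Sum>v\<in>?B. of_nat (word_factor k u (\<lambda>u'. count (stuffle u' v) w)) * S u * T v)
      + (\<Sum>u\<in>?B. \<Sum>v\<in>?B. of_nat (word_factor k v (\<lambda>v'. count (stuffle u v') w)) * S u * T v)
      + (\<Sum>u\<in>?B. \<Sum>v\<in>?B. \<Sum>i\<le>k. of_nat (word_factor i u (\<lambda>u'. word_factor (k - i) v
           (\<lambda>v'. count (stuffle u' v') w))) * S u * T v)"
    by (subst series_prod_word_box[OF factors_below_stuffle, of _ "Suc n" m])
       (simp_all add: n_def m_def count_stuffle_Cons sum.distrib distrib_right sum_distrib_right)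
  also have "(\<Sum>u\<in>?B. \<Sum>v\<in>?B. \<Sum>i\<le>k. of_nat (word_factor i u (\<lambda>u'. word_factor (k - i) v
           (\<lambda>v'. count (stuffle u' v') w))) * S u * T v)
      = (\<Sum>i\<le>k. \<Sum>u\<in>?B. \<Sum>v\<in>?B. of_nat (word_factor i u (\<lambda>u'. word_factor (k - i) v
           (\<lambda>v'. count (stuffle u' v') w))) * S u * T v)"
    by (subst sum.swap[of _ "{..k}"], subst sum.swap[of _ "{..k}"], rule refl)
  also have "\<dots> = (\<Sum>i\<le>k. series_prod stuffle (\<lambda>u. S (i # u)) (\<lambda>v. T ((k - i) # v)) w)"
    by (intro sum.cong refl series_prod_both_factor factors_below_stuffle) (auto simp: n_def m_def)
  finally show ?thesis
    by (simp add: series_prod_left_factor series_prod_right_factor factors_below_stuffle n_def m_def)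
qed

lemma series_prod_shuffle_Cons:
  "series_prod shuffle S T (k # w) = series_prod shuffle (\<lambda>u. S (k # u)) T w
     + series_prod shuffle S (\<lambda>v. T (k # v)) w"
proof -
  define n m where "n = length w" and "m = k + sum_list w"
  let ?B = "word_box (Suc n) m"
  have "series_prod shuffle S T (k # w)
      = (\<Sum>u\<in>?B. \<Sum>v\<in>?B. of_nat (word_factor k u (\<lambda>u'. count (shuffle u' v) w)) * S u * T v)
      + (\<Sum>u\<in>?B. \<Sum>v\<in>?B. of_nat (word_factor k v (\<lambda>v'. count (shuffle u v') w)) * S u * T v)"
    by (subst series_prod_word_box[OF factors_below_shuffle, of _ "Suc n" m])
       (simp_all add: n_def m_def count_shuffle_Cons sum.distrib distrib_right)
  then show ?thesis
    by (simp add: series_prod_left_factor series_prod_right_factor factors_below_shuffle n_def m_def)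
qed

lemma series_prod_scale:
  "series_prod p (\<lambda>u. c * S u) T w = c * series_prod p S T w"
  "series_prod p S (\<lambda>v. c * T v) w = c * series_prod p S T w"
  by (simp_all add: series_prod_def sum_distrib_left case_prod_unfold mult_ac)

text \<open>All left quotients are scalar multiples of the stars themselves, so the recursion for
  the coefficient at \<open>k # w\<close> factors out one scalar per letter. The boundary terms
  \<open>i = 0\<close> and \<open>i = k\<close> vanish as soon as
  \<open>a 0 = b 0 = 0\<close>.\<close>

lemma star_stuffle:
  "series_prod stuffle (star a) (star b) = star (\<lambda>k. a k + b k + (\<Sum>i\<le>k. a i * b (k - i)))"
proof
  fix w show "series_prod stuffle (star a) (star b) w
      = star (\<lambda>k. a k + b k + (\<Sum>i\<le>k. a i * b (k - i))) w"
    by (induction w)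
       (simp_all add: series_prod_stuffle_Nil series_prod_stuffle_Cons series_prod_scale
         distrib_right sum_distrib_right mult.assoc)
qed

lemma star_shuffle: "series_prod shuffle (star a) (star b) = star (\<lambda>k. a k + b k)"
proof
  fix w show "series_prod shuffle (star a) (star b) w = star (\<lambda>k. a k + b k) w"
    by (induction w)
       (simp_all add: series_prod_shuffle_Nil series_prod_shuffle_Cons series_prod_scale distrib_right)
qed

lemma sum_mset_eq_sum_count:
  fixes f :: "'a \<Rightarrow> 'b::comm_semiring_1"
  assumes "finite A" "set_mset M \<subseteq> A"
  shows "(\<Sum>x\<in>#M. f x) = (\<Sum>x\<in>A. of_nat (count M x) * f x)"
  using assms(2)
proof (induction M)
  case (add x M)
  have "(\<Sum>y\<in>A. of_nat (count (add_mset x M) y) * f y)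
      = (\<Sum>y\<in>A. of_nat (count M y) * f y + (if y = x then f x else 0))"
    by (intro sum.cong) (auto simp: algebra_simps)
  then show ?case
    using add assms(1) by (simp add: sum.distrib sum.delta add.commute)
qed simp

section \<open>Weight components under a character\<close>

definition Y_supported :: "series \<Rightarrow> bool" where
  "Y_supported S \<longleftrightarrow> (\<forall>w. w \<notin> Y_words \<longrightarrow> S w = 0)"

lemma Y_supported_star: "c 0 = 0 \<Longrightarrow> Y_supported (star c)"
  by (auto simp: Y_supported_def Y_words_def star_def prod_list_zero_iff image_iff)

lemma stuffle_Y_words: "w \<in># stuffle u v \<Longrightarrow> u \<in> Y_words \<Longrightarrow> v \<in> Y_words \<Longrightarrow> w \<in> Y_words"
  by (induction u v arbitrary: w rule: stuffle.induct) (auto simp: Y_words_def)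

text \<open>Letters of \<open>Y\<close> are positive, so the weight bounds the length as well as
  every letter. This is why a weight component involves finitely many words.\<close>

lemma Y_word_in_word_box:
  assumes "w \<in> Y_words" "sum_list w \<le> n"
  shows "w \<in> word_box n n"
proof -
  have "w \<in> Y_words \<Longrightarrow> length w \<le> sum_list w"
    by (induction w) (auto simp: Y_words_def)
  then show ?thesis
    using assms by (auto simp: word_box_def dest: member_le_sum_list)
qed

lemma finite_Y_words_weight [simp]: "finite {w. w \<in> Y_words \<and> sum_list w = n}"
  by (rule finite_subset[OF _ finite_word_box[of n n]]) (auto intro: Y_word_in_word_box)

lemma gamma_comp_word_box:
  assumes "i \<le> n"
  shows "gamma_comp \<phi> S i
       = (\<Sum>w\<in>word_box n n. if w \<in> Y_words \<and> sum_list w = i then S w * \<phi> w else 0)"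
  unfolding gamma_comp_def
  using assms by (intro sum.mono_neutral_cong_left) (auto intro: Y_word_in_word_box)

text \<open>Multiplicativity is known on \<open>Y_words\<close> only; the support conditions remove
  all other pairs of words.\<close>

lemma gamma_comp_stuffle:
  assumes mult: "\<And>u v. u \<in> Y_words \<Longrightarrow> v \<in> Y_words \<Longrightarrow> (\<Sum>w\<in>#stuffle u v. \<phi> w) = \<phi> u * \<phi> v"
    and S: "Y_supported S" and T: "Y_supported T"
  shows "gamma_comp \<phi> (series_prod stuffle S T) n = (\<Sum>i\<le>n. gamma_comp \<phi> S i * gamma_comp \<phi> T (n - i))"
proof -
  let ?B = "word_box n n" and ?W = "{w. w \<in> Y_words \<and> sum_list w = n}"
  let ?g = "\<lambda>u v. if u \<in> Y_words \<and> v \<in> Y_words \<and> sum_list u + sum_list v = n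
              then S u * \<phi> u * (T v * \<phi> v) else 0"
  \<comment> \<open>For a fixed pair the grading leaves two cases: the weights do not add up to
    \<open>n\<close> and no \<open>w\<close> occurs, or all words of \<open>stuffle u v\<close> have
    weight \<open>n\<close> and the sum over \<open>?W\<close> is the full character
    relation.\<close>
  have *: "(\<Sum>w\<in>?W. of_nat (count (stuffle u v) w) * S u * T v * \<phi> w) = ?g u v" for u v
  proof (cases "u \<in> Y_words \<and> v \<in> Y_words")
    case False
    then show ?thesis using S T by (auto simp: Y_supported_def)
  next
    case True
    show ?thesis
    proof (cases "sum_list u + sum_list v = n")
      case False
      then have "w \<notin># stuffle u v" if "w \<in> ?W" for w
        using that factors_below_stuffle by (force simp: factors_below_def)
      then show ?thesis using False by (simp add: not_in_iff)
    next
      case eq: True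
      have "set_mset (stuffle u v) \<subseteq> ?W"
        using True eq factors_below_stuffle stuffle_Y_words by (force simp: factors_below_def)
      from sum_mset_eq_sum_count[OF _ this, of \<phi>]
      have "(\<Sum>w\<in>?W. of_nat (count (stuffle u v) w) * \<phi> w) = \<phi> u * \<phi> v"
        using mult True by simp
      then have "S u * T v * (\<Sum>w\<in>?W. of_nat (count (stuffle u v) w) * \<phi> w) = S u * T v * (\<phi> u * \<phi> v)"
        by simp
      then show ?thesis using True eq by (simp add: sum_distrib_left mult_ac)
    qed
  qed
  have "gamma_comp \<phi> (series_prod stuffle S T) n
      = (\<Sum>w\<in>?W. (\<Sum>u\<in>?B. \<Sum>v\<in>?B. of_nat (count (stuffle u v) w) * S u * T v) * \<phi> w)"
    unfolding gamma_comp_def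
    by (intro sum.cong refl, subst series_prod_word_box[OF factors_below_stuffle, of _ n n])
       (auto dest: Y_word_in_word_box[of _ n] simp: word_box_def)
  also have "\<dots> = (\<Sum>u\<in>?B. \<Sum>v\<in>?B. \<Sum>w\<in>?W. of_nat (count (stuffle u v) w) * S u * T v * \<phi> w)"
    by (simp only: sum_distrib_right, subst sum.swap, intro sum.cong refl sum.swap)
  also have "\<dots> = (\<Sum>u\<in>?B. \<Sum>v\<in>?B. ?g u v)"
    by (simp only: *)
  \<comment> \<open>A redundant index \<open>i\<close> for the weight of \<open>u\<close> is
    introduced; it decouples the joint condition on \<open>u\<close> and \<open>v\<close>.\<close>
  also have "\<dots> = (\<Sum>u\<in>?B. \<Sum>v\<in>?B. \<Sum>i\<le>n.
      (if u \<in> Y_words \<and> sum_list u = i then S u * \<phi> u else 0) *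
      (if v \<in> Y_words \<and> sum_list v = n - i then T v * \<phi> v else 0))"
  proof (intro sum.cong refl)
    fix u v
    have "(\<Sum>i\<le>n. (if u \<in> Y_words \<and> sum_list u = i then S u * \<phi> u else 0) *
        (if v \<in> Y_words \<and> sum_list v = n - i then T v * \<phi> v else 0))
      = (\<Sum>i\<le>n. if i = sum_list u then (if u \<in> Y_words \<and> v \<in> Y_words \<and> sum_list v = n - sum_list u
          then S u * \<phi> u * (T v * \<phi> v) else 0) else 0)"
      by (intro sum.cong) auto
    also have "\<dots> = ?g u v" by (auto simp: sum.delta)
    finally show "?g u v = (\<Sum>i\<le>n. (if u \<in> Y_words \<and> sum_list u = i then S u * \<phi> u else 0) *
        (if v \<in> Y_words \<and> sum_list v = n - i then T v * \<phi> v else 0))" ..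
  qed
  also have "\<dots> = (\<Sum>i\<le>n. \<Sum>u\<in>?B. \<Sum>v\<in>?B.
      (if u \<in> Y_words \<and> sum_list u = i then S u * \<phi> u else 0) *
      (if v \<in> Y_words \<and> sum_list v = n - i then T v * \<phi> v else 0))"
    by (subst sum.swap[of _ "{..n}"], subst sum.swap[of _ "{..n}"], rule refl)
  also have "\<dots> = (\<Sum>i\<le>n. gamma_comp \<phi> S i * gamma_comp \<phi> T (n - i))"
    by (intro sum.cong refl) (simp add: gamma_comp_word_box[of _ n] sum_product)
  finally show ?thesis .
qed

lemma star_single:
  "star (\<lambda>k. if k = r then c else 0) w = (if w = replicate (length w) r then c ^ length w else 0)"
  by (induction w) auto

lemma gamma_comp_star_single:
  assumes "r \<ge> 1"
  shows "gamma_comp \<phi> (star (\<lambda>k. if k = r then c else 0)) n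
       = (if r dvd n then c ^ (n div r) * \<phi> (replicate (n div r) r) else 0)"
proof (cases "r dvd n")
  case True
  then obtain m where n: "n = m * r" by (metis dvdE mult.commute)
  have "gamma_comp \<phi> (star (\<lambda>k. if k = r then c else 0)) n
      = (\<Sum>w\<in>{replicate m r}. star (\<lambda>k. if k = r then c else 0) w * \<phi> w)"
    unfolding gamma_comp_def
  proof (rule sum.mono_neutral_right)
    show "{replicate m r} \<subseteq> {w. w \<in> Y_words \<and> sum_list w = n}"
      using assms n by (auto simp: Y_words_def sum_list_replicate)
    show "\<forall>w\<in>{w. w \<in> Y_words \<and> sum_list w = n} - {replicate m r}.
        star (\<lambda>k. if k = r then c else 0) w * \<phi> w = 0"
    proof
      fix w assume w: "w \<in> {w. w \<in> Y_words \<and> sum_list w = n} - {replicate m r}"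
      have "w \<noteq> replicate (length w) r"
      proof
        assume eq: "w = replicate (length w) r"
        have "length w * r = m * r"
          using w n arg_cong[OF eq, of sum_list] by (simp only: sum_list_replicate) simp
        then have "length w = m" using assms by simp
        then show False using eq w by simp
      qed
      then show "star (\<lambda>k. if k = r then c else 0) w * \<phi> w = 0" by (simp add: star_single)
    qed
  qed simp
  then show ?thesis using assms n by (simp add: star_single)
next
  case False
  have "star (\<lambda>k. if k = r then c else 0) w = 0" if "sum_list w = n" for w
    using False that by (metis dvd_triv_right star_single sum_list_replicate)
  then show ?thesis using False by (simp add: gamma_comp_def)
qed

section \<open>Newton's identities\<close>

text \<open>The value of \<open>f\<close> on the shuffle of the letter \<open>x\<close> with the
  word \<open>y_r^m\<close>, written out by the position of \<open>x\<close>.\<close>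

definition insert_sum :: "nat \<Rightarrow> nat \<Rightarrow> nat \<Rightarrow> (word \<Rightarrow> complex) \<Rightarrow> complex" where
  "insert_sum r x m f = (\<Sum>i\<le>m. f (replicate i r @ x # replicate (m - i) r))"

lemma insert_sum_Suc:
  "insert_sum r x (Suc m) f = f (x # replicate (Suc m) r) + insert_sum r x m (\<lambda>w. f (r # w))"
  unfolding insert_sum_def by (subst sum.atMost_Suc_shift) simp

text \<open>The letter \<open>x\<close> is either inserted among the \<open>Suc m\<close> letters
  \<open>r\<close> or merged with one of them, which leaves \<open>x + r\<close> among
  \<open>m\<close> letters \<open>r\<close>.\<close>

lemma sum_stuffle_replicate:
  "(\<Sum>w\<in>#stuffle [x] (replicate (Suc m) r). f w) = insert_sum r x (Suc m) f + insert_sum r (x + r) m f"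
proof (induction m arbitrary: f)
  case 0
  then show ?case by (simp add: insert_sum_def)
next
  case (Suc m)
  have "(\<Sum>w\<in>#stuffle [x] (replicate (Suc (Suc m)) r). f w)
      = f (x # replicate (Suc (Suc m)) r) + (\<Sum>w\<in>#stuffle [x] (replicate (Suc m) r). f (r # w))
        + f ((x + r) # replicate (Suc m) r)"
    by (simp add: image_mset.compositionality comp_def)
  also have "\<dots> = insert_sum r x (Suc (Suc m)) f + insert_sum r (x + r) (Suc m) f"
    unfolding Suc.IH insert_sum_Suc[of r x "Suc m"] insert_sum_Suc[of r "x + r" m]
    by (simp add: algebra_simps)
  finally show ?case .
qed

text \<open>All \<open>Suc m\<close> insertions of \<open>r\<close> give the same word; this is the
  source of the factor \<open>Suc n\<close> in Newton's identities.\<close>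

lemma insert_sum_self: "insert_sum r r m f = of_nat (Suc m) * f (replicate (Suc m) r)"
proof -
  have "replicate i r @ r # replicate (m - i) r = replicate (Suc m) r" if "i \<le> m" for i
    using that by (metis add_Suc_right le_add_diff_inverse replicate_Suc replicate_add)
  then show ?thesis by (simp add: insert_sum_def)
qed

text \<open>The products \<open>y\<^bsub>kr\<^esub> * y\<^sub>r\<^sup>n\<close> are sums of two consecutive insertion sums, so that an alternating sum
  of them telescopes.\<close>

lemma newton_identity:
  fixes \<phi> :: "word \<Rightarrow> complex"
  assumes mult: "\<And>u v. u \<in> Y_words \<Longrightarrow> v \<in> Y_words \<Longrightarrow> (\<Sum>w\<in>#stuffle u v. \<phi> w) = \<phi> u * \<phi> v"
    and one: "\<phi> [] = 1" and r: "r \<ge> 1"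
  shows "of_nat (Suc n) * \<phi> (replicate (Suc n) r)
       = (\<Sum>j\<le>n. (-1) ^ j * \<phi> [Suc j * r] * \<phi> (replicate (n - j) r))"
proof -
  \<comment> \<open>The claim is needed for all \<open>k\<close>, since each telescoping step trades
    one letter \<open>r\<close> for an increase of \<open>k\<close> by one. The identity itself is
    the case \<open>k = 1\<close>.\<close>
  have *: "insert_sum r (k * r) n \<phi> = (\<Sum>j\<le>n. (-1) ^ j * \<phi> [(k + j) * r] * \<phi> (replicate (n - j) r))"
    if "k \<ge> 1" for k
    using that
  proof (induction n arbitrary: k)
    case 0
    then show ?case by (simp add: insert_sum_def one)
  next
    case (Suc n)
    have "\<phi> [k * r] * \<phi> (replicate (Suc n) r) = (\<Sum>w\<in>#stuffle [k * r] (replicate (Suc n) r). \<phi> w)"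
      using Suc.prems r by (intro mult[symmetric]) (auto simp: Y_words_def)
    also have "\<dots> = insert_sum r (k * r) (Suc n) \<phi> + insert_sum r (Suc k * r) n \<phi>"
      by (simp only: sum_stuffle_replicate mult_Suc add.commute)
    finally have "insert_sum r (k * r) (Suc n) \<phi>
        = \<phi> [k * r] * \<phi> (replicate (Suc n) r) - insert_sum r (Suc k * r) n \<phi>"
      by simp
    also have "\<dots> = (\<Sum>j\<le>Suc n. (-1) ^ j * \<phi> [(k + j) * r] * \<phi> (replicate (Suc n - j) r))"
      by (subst Suc.IH, simp, subst sum.atMost_Suc_shift) (simp add: sum_negf)
    finally show ?case .
  qed
  show ?thesis
    using *[of 1] by (simp add: insert_sum_self)
qed

section \<open>Values on single letters\<close>

lemma summable_zeta: "k \<ge> 2 \<Longrightarrow> summable (\<lambda>n. norm (1 / of_nat (Suc n) ^ k :: complex))"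
  using inverse_power_summable[of k, where 'a = real, THEN summable_Suc_iff[THEN iffD2]]
  unfolding norm_divide norm_power norm_of_nat norm_one inverse_eq_divide .

text \<open>Termwise comparison with the series of zeta(2). The bound does not depend on
  \<open>k\<close>, hence serves all letters simultaneously.\<close>

lemma norm_zeta_le:
  assumes "k \<ge> 2"
  shows "norm (zeta k) \<le> (\<Sum>n. norm (1 / of_nat (Suc n) ^ 2 :: complex))"
proof -
  have "norm (zeta k) \<le> (\<Sum>n. norm (1 / of_nat (Suc n) ^ k :: complex))"
    unfolding zeta_def by (rule summable_norm[OF summable_zeta[OF assms]])
  also have "\<dots> \<le> (\<Sum>n. norm (1 / of_nat (Suc n) ^ 2 :: complex))"
  proof (rule suminf_le[OF _ summable_zeta[OF assms] summable_zeta])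
    fix n
    have "(real (Suc n)) ^ 2 \<le> real (Suc n) ^ k"
      using assms by (intro power_increasing) auto
    then show "norm (1 / of_nat (Suc n) ^ k :: complex) \<le> norm (1 / of_nat (Suc n) ^ 2 :: complex)"
      unfolding norm_divide norm_power norm_of_nat by (intro divide_left_mono) auto
  qed simp
  finally show ?thesis .
qed

lemma polyzeta_single:
  assumes "k \<ge> 2"
  shows "polyzeta [k] = zeta k"
proof -
  have bij: "bij_betw (\<lambda>m. [Suc m]) UNIV {n :: nat list. length n = 1 \<and> sorted_wrt (>) n \<and> 0 \<notin> set n}"
  proof (rule bij_betwI[where g = "\<lambda>n. hd n - 1"])
    show "(\<lambda>n. hd n - 1) \<in> {n :: nat list. length n = 1 \<and> sorted_wrt (>) n \<and> 0 \<notin> set n} \<rightarrow> UNIV" by simp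
    fix n :: "nat list" assume "n \<in> {n. length n = 1 \<and> sorted_wrt (>) n \<and> 0 \<notin> set n}"
    then show "[Suc (hd n - 1)] = n" by (auto simp: length_Suc_conv)
  qed auto
  have "polyzeta [k] = (\<Sum>\<^sub>\<infinity>n \<in> {n :: nat list. length n = 1 \<and> sorted_wrt (>) n \<and> 0 \<notin> set n}. 1 / of_nat (hd n) ^ k)"
    unfolding polyzeta_def by (intro infsum_cong_neutral) (auto simp: length_Suc_conv)
  also have "\<dots> = (\<Sum>\<^sub>\<infinity>m. 1 / of_nat (Suc m) ^ k)"
    by (subst infsum_reindex_bij_betw[OF bij, symmetric]) simp
  also have "\<dots> = zeta k"
    unfolding zeta_def
    by (intro infsumI norm_summable_imp_has_sum[OF summable_zeta[OF assms]] summable_sums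
        summable_norm_cancel[OF summable_zeta[OF assms]])
  finally show ?thesis .
qed

lemma lyndon_single: "k \<ge> 1 \<Longrightarrow> lyndon [k]"
  by (auto simp: lyndon_def Y_words_def Cons_eq_append_conv)

lemma gamma_character_letter:
  assumes "gamma_character \<phi>" "k \<ge> 2"
  shows "\<phi> [k] = zeta k"
  using assms lyndon_single[of k] polyzeta_single[of k] by (simp add: gamma_character_def)

section \<open>Stars of a single letter\<close>

text \<open>In characteristic 0 the equation determines each coefficient from the earlier
  ones.\<close>

lemma fps_deriv_mult_unique:
  fixes F G :: "'a::field_char_0 fps"
  assumes "fps_deriv F = P * F" "fps_deriv G = P * G" "F $ 0 = G $ 0"
  shows "F = G"
proof -
  have "F $ n = G $ n" for n
  proof (induction n rule: less_induct)
    case (less n)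
    show ?case
    proof (cases n)
      case (Suc m)
      have "fps_deriv F $ m = fps_deriv G $ m"
        unfolding assms(1,2) fps_mult_nth using less.IH Suc by (intro sum.cong) auto
      then show ?thesis using Suc by (simp del: of_nat_Suc)
    qed (use assms in simp)
  qed
  then show ?thesis by (simp add: fps_eq_iff)
qed

lemma fps_conv_radius_ge_1:
  fixes F :: "complex fps"
  assumes "\<And>n. norm (F $ n) \<le> K"
  shows "fps_conv_radius F \<ge> 1"
  unfolding fps_conv_radius_def
proof (rule conv_radius_geI_ex')
  fix x :: real assume "0 < x" "ereal x < 1"
  then have x: "0 < x" "x < 1" by auto
  show "summable (\<lambda>n. F $ n * of_real x ^ n)"
  proof (rule summable_comparison_test')
    show "summable (\<lambda>n. K * x ^ n)" using x by (intro summable_mult summable_geometric) auto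
    show "norm (F $ n * of_real x ^ n) \<le> K * x ^ n" for n
      using assms[of n] x by (simp add: norm_mult norm_power mult_right_mono)
  qed
qed

definition single_star :: "nat \<Rightarrow> complex \<Rightarrow> series" where
  "single_star r c = star (\<lambda>k. if k = r then c else 0)"

lemma kleene_star_yterm: "kleene_star (yterm c r) = single_star r c"
  by (simp add: yterm_eq_letter_series kleene_star_letter_series single_star_def)

lemma Y_supported_single_star: "r \<ge> 1 \<Longrightarrow> Y_supported (single_star r c)"
  by (simp add: single_star_def Y_supported_star)

lemma single_star_stuffle:
  assumes "r \<ge> 1" "s \<ge> 1"
  shows "series_prod stuffle (single_star s c) (single_star r d)
       = kleene_star (yterm c s + yterm d r + yterm (c * d) (s + r))"
proof -
  have "(\<Sum>i\<le>k. (if i = s then c else 0) * (if k - i = r then d else 0))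
      = (if k = s + r then c * d else 0)" for k
  proof -
    have "(\<Sum>i\<le>k. (if i = s then c else 0) * (if k - i = r then d else 0))
        = (\<Sum>i\<le>k. if i = s then (if k - s = r then c * d else 0) else 0)"
      by (intro sum.cong) auto
    then show ?thesis using assms by (auto simp: sum.delta)
  qed
  then show ?thesis
    by (simp add: single_star_def star_stuffle yterm_eq_letter_series letter_series_add
        kleene_star_letter_series)
qed

text \<open>The counterpart of (1 + c x^s)(1 - c x^s) = 1 - c^2 x^(2s): the linear terms
  cancel.\<close>

lemma single_star_stuffle_opposite:
  assumes "s \<ge> 1"
  shows "series_prod stuffle (single_star s c) (single_star s (- c)) = kleene_star (yterm (- (c ^ 2)) (2 * s))"
proof -
  have "yterm c s + yterm (- c) s + yterm (c * - c) (s + s) = yterm (- (c ^ 2)) (2 * s)"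
    by (auto simp: fun_eq_iff yterm_def power2_eq_square)
  then show ?thesis using single_star_stuffle[OF assms assms, of c "- c"] by simp
qed

locale stuffle_gamma =
  fixes \<phi> :: "word \<Rightarrow> complex"
  assumes gamma: "gamma_character \<phi>"
begin

lemma character_mult: "u \<in> Y_words \<Longrightarrow> v \<in> Y_words \<Longrightarrow> (\<Sum>w\<in>#stuffle u v. \<phi> w) = \<phi> u * \<phi> v"
  using gamma by (simp add: gamma_character_def)

lemma character_one: "\<phi> [] = 1"
  using gamma by (simp add: gamma_character_def)

text \<open>A sum instead of a maximum, so that it dominates both \<open>\<phi> [1]\<close>, which
  is Euler's constant, and the zeta values at all other letters.\<close>

definition letter_bound :: real where
  "letter_bound = euler_mascheroni + (\<Sum>n. norm (1 / of_nat (Suc n) ^ 2 :: complex))"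

lemma norm_letter_le: "k \<ge> 1 \<Longrightarrow> norm (\<phi> [k]) \<le> letter_bound"
proof -
  assume k: "k \<ge> 1"
  have pos: "(\<Sum>n. norm (1 / of_nat (Suc n) ^ 2 :: complex)) \<ge> 0"
    by (rule suminf_nonneg[OF summable_zeta]) auto
  show ?thesis
  proof (cases "k = 1")
    case True
    have "norm (\<phi> [k]) = norm (of_real euler_mascheroni :: complex)"
      using True gamma by (simp add: gamma_character_def)
    also have "\<dots> = euler_mascheroni"
      using euler_mascheroni_pos unfolding norm_of_real by simp
    finally show ?thesis using pos by (simp add: letter_bound_def)
  next
    case False
    then show ?thesis
      using norm_zeta_le[of k] k gamma_character_letter[OF gamma, of k] euler_mascheroni_pos
      by (simp add: letter_bound_def)
  qed
qed

lemma letter_bound_nonneg: "letter_bound \<ge> 0"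
  using norm_letter_le[of 1] norm_ge_zero[of "\<phi> [1]"] by linarith

text \<open>Formal version of \<open>ell r\<close> in the variable \<open>z ^ r\<close>. It is
  introduced as an integral so that its derivative is literally the series of letter values in
  Newton's identities.\<close>

definition letter_log :: "nat \<Rightarrow> complex fps" where
  "letter_log r = fps_integral0 (Abs_fps (\<lambda>j. (-1) ^ j * \<phi> [Suc j * r]))"

lemma letter_log_nth_0 [simp]: "letter_log r $ 0 = 0"
  by (simp add: letter_log_def fps_integral_def)

lemma letter_log_nth_Suc: "letter_log r $ Suc j = (-1) ^ j * \<phi> [Suc j * r] / of_nat (Suc j)"
  by (simp add: letter_log_def fps_integral_def divide_inverse mult.commute)

lemma norm_letter_log_nth_Suc_le:
  assumes "r \<ge> 1"
  shows "norm (letter_log r $ Suc j) \<le> letter_bound"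
proof -
  have "norm (letter_log r $ Suc j) = norm (\<phi> [Suc j * r]) / real (Suc j)"
    by (simp only: letter_log_nth_Suc norm_divide norm_mult norm_power norm_of_nat) simp
  also have "\<dots> \<le> norm (\<phi> [Suc j * r]) / 1"
    by (intro divide_left_mono) auto
  finally show ?thesis
    using norm_letter_le[of "Suc j * r"] assms by simp
qed

lemma letter_log_conv_radius: "r \<ge> 1 \<Longrightarrow> fps_conv_radius (letter_log r) \<ge> 1"
proof (rule fps_conv_radius_ge_1)
  fix n assume "r \<ge> 1"
  then show "norm (letter_log r $ n) \<le> letter_bound"
    using norm_letter_log_nth_Suc_le letter_bound_nonneg by (cases n) auto
qed

lemma letter_log_converges:
  assumes "r \<ge> 1" "norm c < 1"
  shows "ereal (norm c) < fps_conv_radius (letter_log r)"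
proof -
  have "ereal (norm c) < 1" using assms(2) by (simp add: one_ereal_def)
  then show ?thesis using letter_log_conv_radius[OF assms(1)] by (rule less_le_trans)
qed

lemma letter_log_sums:
  assumes "r \<ge> 1" "norm c < 1"
  shows "(\<lambda>j. letter_log r $ Suc j * c ^ Suc j) sums eval_fps (letter_log r) c"
proof -
  have "(\<lambda>n. letter_log r $ n * c ^ n) sums eval_fps (letter_log r) c"
    by (rule sums_eval_fps[OF letter_log_converges[OF assms]])
  then show ?thesis by (subst sums_Suc_iff) simp
qed


text \<open>Geometric majorant. The factor \<open>norm c\<close> is due to the vanishing constant
  term and is what produces decay in \<open>r\<close> once \<open>c = z ^ r\<close>.\<close>

lemma norm_letter_log_le:
  assumes "r \<ge> 1" "norm c < 1"
  shows "norm (eval_fps (letter_log r) c) \<le> letter_bound * norm c / (1 - norm c)"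
proof -
  have *: "norm (letter_log r $ Suc j * c ^ Suc j) \<le> letter_bound * norm c * norm c ^ j" for j
    using mult_right_mono[OF norm_letter_log_nth_Suc_le[OF assms(1)], of "norm c ^ Suc j" j]
    by (simp add: norm_mult norm_power mult.assoc)
  have geom: "(\<lambda>j. letter_bound * norm c * norm c ^ j) sums (letter_bound * norm c * (1 / (1 - norm c)))"
    using assms by (intro sums_mult geometric_sums) simp
  have "norm (\<Sum>j. letter_log r $ Suc j * c ^ Suc j) \<le> (\<Sum>j. letter_bound * norm c * norm c ^ j)"
    using geom by (intro norm_suminf_le * sums_summable)
  then show ?thesis
    using letter_log_sums[OF assms] geom by (simp add: sums_iff)
qed

text \<open>The case \<open>r = 1\<close> is separate because \<open>ell 1\<close> carries its
  linear term outside the sum, with Euler's constant in the place of a zeta value; the first term of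
  the power series has to be split off there.\<close>

lemma ell_eq:
  assumes "r \<ge> 1" "norm z < 1"
  shows "ell r z = eval_fps (letter_log r) (z ^ r)"
proof -
  have zr: "norm (z ^ r) < 1"
    using assms by (simp add: norm_power power_less_one_iff)
  note S = letter_log_sums[OF assms(1) zr]
  show ?thesis
  proof (cases "r = 1")
    case True
    have "(\<lambda>j. letter_log 1 $ Suc (Suc j) * z ^ Suc (Suc j)) sums
        (eval_fps (letter_log 1) z - euler_mascheroni * z)"
      using S True gamma by (subst sums_Suc_iff) (simp add: letter_log_nth_Suc gamma_character_def)
    moreover have "letter_log 1 $ Suc (Suc j) * z ^ Suc (Suc j)
        = - (zeta (j + 2) * (- z) ^ (j + 2) / of_nat (j + 2))" for j
      using gamma_character_letter[OF gamma, of "j + 2"]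
      by (simp add: letter_log_nth_Suc power_minus[of z] del: of_nat_Suc)
    ultimately have "(\<lambda>j. zeta (j + 2) * (- z) ^ (j + 2) / of_nat (j + 2)) sums
        - (eval_fps (letter_log 1) z - euler_mascheroni * z)"
      using sums_minus by fastforce
    then show ?thesis using True by (simp add: ell_def sums_iff)
  next
    case False
    have "letter_log r $ Suc j * (z ^ r) ^ Suc j
        = - (zeta (Suc j * r) * (- (z ^ r)) ^ Suc j / of_nat (Suc j))" for j
    proof -
      have "\<phi> [Suc j * r] = zeta (Suc j * r)"
        using False assms(1) by (intro gamma_character_letter[OF gamma]) (simp add: add_increasing2)
      then show ?thesis
        by (simp only: letter_log_nth_Suc power_minus[of "z ^ r"]) simp
    qed
    then have "(\<lambda>j. zeta (Suc j * r) * (- (z ^ r)) ^ Suc j / of_nat (Suc j)) sums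
        - eval_fps (letter_log r) (z ^ r)"
      using sums_minus[OF S] by simp
    then show ?thesis using False by (simp add: ell_def sums_iff)
  qed
qed

text \<open>For \<open>r \<ge> 1\<close> one has |z^r| \<le> \<open>\<rho>\<close>, so the
  denominator is bounded below independently of \<open>r\<close>. The resulting majorant is
  geometric in \<open>r\<close>.\<close>

lemma norm_ell_le:
  assumes "r \<ge> 1" "norm z \<le> \<rho>" "\<rho> < 1"
  shows "norm (ell r z) \<le> letter_bound / (1 - \<rho>) * \<rho> ^ r"
proof -
  have \<rho>: "\<rho> \<ge> 0" using assms(2) norm_ge_zero order_trans by blast
  have le: "norm (z ^ r) \<le> \<rho> ^ r"
    using assms by (simp add: norm_power power_mono)
  have "\<rho> ^ r \<le> \<rho> ^ 1"
    using \<rho> assms by (intro power_decreasing) auto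
  then have le': "norm (z ^ r) \<le> \<rho>" using le by simp
  have "norm (ell r z) \<le> letter_bound * norm (z ^ r) / (1 - norm (z ^ r))"
    using assms le' by (subst ell_eq) (auto intro!: norm_letter_log_le)
  also have "\<dots> \<le> letter_bound * \<rho> ^ r / (1 - \<rho>)"
    using letter_bound_nonneg le le' assms \<rho>
    by (intro frac_le mult_left_mono mult_nonneg_nonneg) auto
  finally show ?thesis by simp
qed

lemma holomorphic_letter_log: "r \<ge> 1 \<Longrightarrow> eval_fps (letter_log r) holomorphic_on ball 0 1"
  using letter_log_converges by (intro holomorphic_on_eval_fps subsetI) (simp add: in_eball_iff)

lemma holomorphic_ell: "r \<ge> 1 \<Longrightarrow> ell r holomorphic_on ball 0 1"
proof -
  assume r: "r \<ge> 1"
  have "(eval_fps (letter_log r) \<circ> (\<lambda>z. z ^ r)) holomorphic_on ball 0 1"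
    using r by (intro holomorphic_on_compose_gen[OF _ holomorphic_letter_log[OF r]] holomorphic_intros)
      (auto simp: norm_power power_less_one_iff)
  then show ?thesis
    by (rule holomorphic_transform) (simp add: ell_eq[OF r])
qed

lemma ell_0 [simp]: "r \<ge> 1 \<Longrightarrow> ell r 0 = 0"
  by (simp add: ell_eq eval_fps_at_0 zero_power)

text \<open>No growth estimate for the values on \<open>y_r^n\<close> is made: their generating
  series is the Taylor series of a function holomorphic in the unit disc, and so converges
  absolutely there.\<close>

lemma star_sums:
  assumes "r \<ge> 1" "norm c < 1"
  shows "(\<lambda>n. \<phi> (replicate n r) * c ^ n) sums exp (eval_fps (letter_log r) c)"
    and "summable (\<lambda>n. norm (\<phi> (replicate n r) * c ^ n))"
proof -
  let ?F = "Abs_fps (\<lambda>n. \<phi> (replicate n r))" and ?p = "Abs_fps (\<lambda>j. (-1) ^ j * \<phi> [Suc j * r])"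
  have "fps_deriv ?F = ?p * ?F"
    using newton_identity[OF character_mult character_one assms(1)]
    by (simp add: fps_eq_iff fps_mult_nth atLeast0AtMost)
  moreover have "fps_deriv (fps_exp 1 oo letter_log r) = ?p * (fps_exp 1 oo letter_log r)"
    by (subst fps_compose_deriv) (simp_all add: letter_log_def fps_deriv_fps_integral mult.commute)
  ultimately have F: "?F = fps_exp 1 oo letter_log r"
    by (rule fps_deriv_mult_unique) (simp add: character_one)
  have "0 < fps_conv_radius (letter_log r)"
    using letter_log_conv_radius[OF assms(1)] by (rule less_le_trans[rotated]) simp
  then have "(exp \<circ> eval_fps (letter_log r)) has_fps_expansion (fps_exp 1 oo letter_log r)"
    by (intro has_fps_expansion_compose has_fps_expansion_exp1 eval_fps_has_fps_expansion) auto
  then have exp: "(exp \<circ> eval_fps (letter_log r)) has_fps_expansion ?F" by (simp only: F)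
  have hol: "(exp \<circ> eval_fps (letter_log r)) holomorphic_on eball 0 1"
    using holomorphic_on_compose[OF holomorphic_letter_log[OF assms(1)], of exp]
    by (simp add: one_ereal_def holomorphic_on_exp)
  have c: "ereal (norm c) < 1" using assms(2) by (simp add: one_ereal_def)
  show "(\<lambda>n. \<phi> (replicate n r) * c ^ n) sums exp (eval_fps (letter_log r) c)"
    using has_fps_expansion_imp_sums_complex[OF exp hol c] by simp
  have "ereal (norm c) < fps_conv_radius ?F"
    using c holomorphic_on_imp_fps_conv_radius_ge[OF exp hol] by (rule less_le_trans)
  then show "summable (\<lambda>n. norm (\<phi> (replicate n r) * c ^ n))"
    using norm_summable_fps[of c ?F] by simp
qed

lemma gamma_comp_single_star_sums:
  assumes "r \<ge> 1" "norm c < 1"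
  shows "gamma_comp \<phi> (single_star r c) sums exp (eval_fps (letter_log r) c)"
    and "summable (\<lambda>n. norm (gamma_comp \<phi> (single_star r c) n))"
proof -
  \<comment> \<open>Only weights divisible by \<open>r\<close> occur, so the series over weights is
    the series over powers, reindexed along \<open>n * r\<close>.\<close>
  have mono: "strict_mono (\<lambda>n. n * r)" using assms(1) by (simp add: strict_mono_def)
  have zero: "gamma_comp \<phi> (single_star r c) n = 0" if "n \<notin> range (\<lambda>n. n * r)" for n
    using that assms(1) by (auto simp: single_star_def gamma_comp_star_single image_iff mult.commute)
  have eq: "gamma_comp \<phi> (single_star r c) (n * r) = \<phi> (replicate n r) * c ^ n" for n
    using assms(1) by (simp add: single_star_def gamma_comp_star_single)
  show "gamma_comp \<phi> (single_star r c) sums exp (eval_fps (letter_log r) c)"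
    using star_sums(1)[OF assms] sums_mono_reindex[OF mono, of "gamma_comp \<phi> (single_star r c)"] zero
    by (simp add: eq)
  show "summable (\<lambda>n. norm (gamma_comp \<phi> (single_star r c) n))"
    using star_sums(2)[OF assms] summable_mono_reindex[OF mono, of "\<lambda>n. norm (gamma_comp \<phi> (single_star r c) n)"] zero
    by (simp add: eq)
qed

lemma gamma_dom_single_star:
  assumes "r \<ge> 1" "norm c < 1"
  shows "gamma_dom \<phi> (kleene_star (yterm c r))"
  using gamma_comp_single_star_sums(1)[OF assms]
  by (simp add: gamma_dom_def kleene_star_yterm sums_iff)

text \<open>Under absolute convergence, membership of the product in the domain is part of the
  conclusion. This is the version for stars of single letters.\<close>

lemma gamma_ext_mult:
  assumes S: "Y_supported S" "summable (\<lambda>n. norm (gamma_comp \<phi> S n))"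
    and T: "Y_supported T" "summable (\<lambda>n. norm (gamma_comp \<phi> T n))"
  shows "gamma_dom \<phi> (series_prod stuffle S T)"
    and "gamma_ext \<phi> (series_prod stuffle S T) = gamma_ext \<phi> S * gamma_ext \<phi> T"
proof -
  have "gamma_comp \<phi> (series_prod stuffle S T) sums (gamma_ext \<phi> S * gamma_ext \<phi> T)"
    using Cauchy_product_sums[OF S(2) T(2)] gamma_comp_stuffle[OF character_mult S(1) T(1)]
    unfolding gamma_ext_def by presburger
  then show "gamma_dom \<phi> (series_prod stuffle S T)"
    and "gamma_ext \<phi> (series_prod stuffle S T) = gamma_ext \<phi> S * gamma_ext \<phi> T"
    by (simp_all add: gamma_dom_def gamma_ext_def sums_iff)
qed

end

section \<open>The infinite stuffle product\<close>

lemma one_series_eq_star: "one_series = star (\<lambda>_. 0)"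
  by (auto simp: fun_eq_iff one_series_def star_def prod_list_zero_iff neq_Nil_conv)

lemma star_cong: "(\<And>k. k \<in> set w \<Longrightarrow> c k = d k) \<Longrightarrow> star c w = star d w"
  by (simp add: star_def cong: map_cong)

definition stuffle_upto :: "complex \<Rightarrow> nat \<Rightarrow> series" where
  "stuffle_upto z N = series_prod_upto stuffle (\<lambda>r. single_star r (z ^ r)) N"

text \<open>The witness consists of the coefficients of the product of the factors 1 + z^r x^r over
  1 \<le> r \<le> N, built up recursively.\<close>

lemma stuffle_upto_star: "\<exists>c. c 0 = 0 \<and> stuffle_upto z N = star c"
proof (induction N)
  case 0
  then show ?case by (auto simp: stuffle_upto_def one_series_eq_star)
next
  case (Suc N)
  then obtain c where c: "c 0 = 0" "stuffle_upto z N = star c" by blast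
  then show ?case
    by (intro exI[of _ "\<lambda>k. c k + (if k = Suc N then z ^ Suc N else 0)
          + (\<Sum>i\<le>k. c i * (if k - i = Suc N then z ^ Suc N else 0))"])
       (simp add: stuffle_upto_def single_star_def star_stuffle)
qed

lemma Y_supported_stuffle_upto: "Y_supported (stuffle_upto z N)"
  using stuffle_upto_star[of z N] Y_supported_star by auto

text \<open>The factor 1 + z^(N+1) x^(N+1) changes only coefficients of degree above
  \<open>N\<close>. Hence the finite products are eventually constant at each word, and the limit
  defining the infinite product exists.\<close>

lemma stuffle_upto_Suc:
  assumes "set w \<subseteq> {..N}"
  shows "stuffle_upto z (Suc N) w = stuffle_upto z N w"
proof -
  obtain c where c: "c 0 = 0" "stuffle_upto z N = star c" using stuffle_upto_star by blast
  have "stuffle_upto z (Suc N) w = star (\<lambda>k. c k + (if k = Suc N then z ^ Suc N else 0)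
          + (\<Sum>i\<le>k. c i * (if k - i = Suc N then z ^ Suc N else 0))) w"
    using c by (simp add: stuffle_upto_def single_star_def star_stuffle)
  also have "\<dots> = star c w"
    using assms by (intro star_cong) (auto intro!: sum.neutral)
  finally show ?thesis by (simp add: c)
qed

lemma stuffle_upto_mono:
  assumes "set w \<subseteq> {..N}" "N \<le> M"
  shows "stuffle_upto z M w = stuffle_upto z N w"
  using assms(2)
proof (induction M rule: dec_induct)
  case (step m)
  have "set w \<subseteq> {..m}" using assms(1) step(1) by (auto intro: order_trans)
  then show ?case using step.IH by (simp add: stuffle_upto_Suc)
qed simp

definition stuffle_all :: "complex \<Rightarrow> series" where
  "stuffle_all z = series_prod_inf stuffle (\<lambda>r. single_star r (z ^ r))"

lemma stuffle_all_eq: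
  assumes "set w \<subseteq> {..N}"
  shows "stuffle_all z w = stuffle_upto z N w"
  unfolding stuffle_all_def series_prod_inf_def stuffle_upto_def[symmetric]
  by (intro limI tendsto_eventually)
     (auto simp: eventually_at_top_linorder intro!: exI[of _ N] stuffle_upto_mono[OF assms])

text \<open>A word of weight \<open>n\<close> has no letter above \<open>n\<close>, so the component
  of weight \<open>n\<close> of the infinite product can be read off from the first \<open>n\<close>
  factors.\<close>

lemma gamma_comp_cong:
  assumes "\<And>w. set w \<subseteq> {..n} \<Longrightarrow> S w = T w"
  shows "gamma_comp \<phi> S n = gamma_comp \<phi> T n"
  unfolding gamma_comp_def
  by (intro sum.cong refl) (use assms in \<open>auto dest!: member_le_sum_list\<close>)

context stuffle_gamma
begin

lemma gamma_comp_one_series: "gamma_comp \<phi> one_series n = (if n = 0 then 1 else 0)"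
proof -
  have "gamma_comp \<phi> one_series n = (\<Sum>w | w \<in> Y_words \<and> sum_list w = n. if w = [] then \<phi> [] else 0)"
    unfolding gamma_comp_def by (intro sum.cong) (auto simp: one_series_def)
  moreover have "[] \<in> Y_words" by (simp add: Y_words_def)
  ultimately show ?thesis by (simp add: sum.delta character_one)
qed

text \<open>The components at parameter 1, as formal coefficients; no convergence at 1 is meant.
  Replacing 1 by \<open>z ^ r\<close> multiplies the component of weight \<open>n\<close> by
  \<open>z ^ n\<close>.\<close>

definition star_fps :: "nat \<Rightarrow> complex fps" where
  "star_fps r = Abs_fps (gamma_comp \<phi> (single_star r 1))"

lemma gamma_comp_single_star_power:
  "r \<ge> 1 \<Longrightarrow> gamma_comp \<phi> (single_star r (z ^ r)) n = star_fps r $ n * z ^ n"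
  by (auto simp: star_fps_def single_star_def gamma_comp_star_single power_mult[symmetric])

lemma gamma_comp_stuffle_upto:
  "gamma_comp \<phi> (stuffle_upto z N) n = (\<Prod>r=1..N. star_fps r) $ n * z ^ n"
proof (induction N arbitrary: n)
  case 0
  then show ?case by (simp add: stuffle_upto_def gamma_comp_one_series)
next
  case (Suc N)
  have "gamma_comp \<phi> (stuffle_upto z (Suc N)) n
      = (\<Sum>i\<le>n. gamma_comp \<phi> (stuffle_upto z N) i * gamma_comp \<phi> (single_star (Suc N) (z ^ Suc N)) (n - i))"
    using gamma_comp_stuffle[OF character_mult Y_supported_stuffle_upto Y_supported_single_star]
    by (simp add: stuffle_upto_def)
  also have "\<dots> = (\<Sum>i\<le>n. (\<Prod>r=1..N. star_fps r) $ i * star_fps (Suc N) $ (n - i) * z ^ n)"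
    unfolding Suc.IH by (subst gamma_comp_single_star_power) (auto simp: power_add[symmetric] intro!: sum.cong)
  also have "\<dots> = (\<Prod>r=1..Suc N. star_fps r) $ n * z ^ n"
    by (simp add: fps_mult_nth atLeast0AtMost sum_distrib_right)
  finally show ?case .
qed

lemma prod_star_fps_nth:
  assumes "n \<le> N"
  shows "(\<Prod>r=1..N. star_fps r) $ n = gamma_comp \<phi> (stuffle_all 1) n"
proof -
  have "gamma_comp \<phi> (stuffle_all 1) n = gamma_comp \<phi> (stuffle_upto 1 N) n"
    using assms by (intro gamma_comp_cong stuffle_all_eq) auto
  then show ?thesis by (simp add: gamma_comp_stuffle_upto)
qed

lemma gamma_comp_stuffle_all:
  "gamma_comp \<phi> (stuffle_all z) n = gamma_comp \<phi> (stuffle_all 1) n * z ^ n"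
proof -
  have "gamma_comp \<phi> (stuffle_all z) n = gamma_comp \<phi> (stuffle_upto z n) n"
    by (intro gamma_comp_cong stuffle_all_eq) auto
  then show ?thesis using prod_star_fps_nth[of n n] by (simp add: gamma_comp_stuffle_upto)
qed

lemma gamma_single_star_ell:
  assumes "r \<ge> 1" "norm z < 1"
  shows "gamma_comp \<phi> (single_star r (z ^ r)) sums exp (ell r z)"
  using assms gamma_comp_single_star_sums(1)[of r "z ^ r"]
  by (simp add: ell_eq norm_power power_less_one_iff)

lemma exp_ell_has_fps_expansion:
  assumes "r \<ge> 1"
  shows "(\<lambda>z. exp (ell r z)) has_fps_expansion star_fps r"
proof (rule has_fps_expansionI)
  have "eventually (\<lambda>z::complex. z \<in> ball 0 1) (nhds 0)"
    by (rule eventually_nhds_in_open) auto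
  then show "\<forall>\<^sub>F z in nhds 0. (\<lambda>n. star_fps r $ n * z ^ n) sums exp (ell r z)"
  proof eventually_elim
    case (elim z)
    have "gamma_comp \<phi> (single_star r (z ^ r)) = (\<lambda>n. star_fps r $ n * z ^ n)"
      by (rule ext) (rule gamma_comp_single_star_power[OF assms])
    then show ?case
      using gamma_single_star_ell[OF assms, of z] elim by simp
  qed
qed

lemma summable_ell_bound:
  assumes "0 \<le> \<rho>" "\<rho> < 1"
  shows "summable (\<lambda>r. letter_bound / (1 - \<rho>) * \<rho> ^ Suc r)"
  using assms by (intro summable_mult summable_Suc_iff[THEN iffD2] summable_geometric) auto

lemma summable_ell:
  assumes "norm z < 1"
  shows "summable (\<lambda>r. norm (ell (Suc r) z))"
proof (rule summable_comparison_test'[OF summable_ell_bound[of "norm z"]])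
  show "norm (norm (ell (Suc r) z)) \<le> letter_bound / (1 - norm z) * norm z ^ Suc r" for r
    using norm_ell_le[of "Suc r" z "norm z"] assms by simp
qed (use assms in auto)

definition ell_sum :: "complex \<Rightarrow> complex" where
  "ell_sum z = (\<Sum>r. ell (Suc r) z)"

lemma sum_ell_le:
  assumes "0 \<le> \<rho>" "\<rho> < 1" "norm z \<le> \<rho>"
  shows "norm (\<Sum>r<N. ell (Suc r) z) \<le> (\<Sum>r. letter_bound / (1 - \<rho>) * \<rho> ^ Suc r)"
proof -
  have "norm (\<Sum>r<N. ell (Suc r) z) \<le> (\<Sum>r<N. letter_bound / (1 - \<rho>) * \<rho> ^ Suc r)"
    using assms by (intro sum_norm_le norm_ell_le) auto
  also have "\<dots> \<le> (\<Sum>r. letter_bound / (1 - \<rho>) * \<rho> ^ Suc r)"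
    using assms letter_bound_nonneg by (intro sum_le_suminf summable_ell_bound) auto
  finally show ?thesis .
qed

text \<open>Since \<open>exp\<close> is not uniformly continuous on the whole plane,
  \<open>sum_ell_le\<close> is used to keep all partial sums in one compact disc.\<close>

lemma uniform_limit_exp_ell:
  assumes "0 \<le> \<rho>" "\<rho> < 1"
  shows "uniform_limit (ball 0 \<rho>) (\<lambda>N z. exp (\<Sum>r<N. ell (Suc r) z)) (\<lambda>z. exp (ell_sum z)) sequentially"
proof (rule uniform_limit_compose_uniformly_continuous_on[where f = exp])
  show "uniform_limit (ball 0 \<rho>) (\<lambda>N z. \<Sum>r<N. ell (Suc r) z) ell_sum sequentially"
    unfolding ell_sum_def
  proof (rule Weierstrass_m_test[OF _ summable_ell_bound[OF assms]])
    show "norm (ell (Suc r) z) \<le> letter_bound / (1 - \<rho>) * \<rho> ^ Suc r" if "z \<in> ball 0 \<rho>" for r z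
      using that assms by (intro norm_ell_le) auto
  qed
  let ?B = "cball 0 (\<Sum>r. letter_bound / (1 - \<rho>) * \<rho> ^ Suc r) :: complex set"
  show "uniformly_continuous_on ?B exp"
    by (intro compact_uniformly_continuous continuous_intros) auto
  show "\<forall>\<^sub>F N in sequentially. \<forall>z\<in>ball 0 \<rho>. (\<Sum>r<N. ell (Suc r) z) \<in> ?B"
    using sum_ell_le[OF assms] by (intro always_eventually) auto
qed simp

text \<open>The coefficients of the product over \<open>r \<le> N\<close> do not change any more once \<open>N\<close> exceeds the
  degree, and they converge to the Taylor coefficients of the locally uniform limit.\<close>

lemma gamma_stuffle_all_sums:
  assumes "norm z < 1"
  shows "gamma_comp \<phi> (stuffle_all z) sums exp (ell_sum z)"
proof -
  \<comment> \<open>Convergence is uniform on smaller discs only; a radius strictly between |z| and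
    1 keeps \<open>z\<close> inside an open disc.\<close>
  obtain \<rho> where \<rho>: "norm z < \<rho>" "\<rho> < 1" using assms dense by blast
  have \<rho>0: "0 < \<rho>" using \<rho>(1) norm_ge_zero le_less_trans by blast
  let ?E = "\<lambda>N z. exp (\<Sum>r<N. ell (Suc r) z)"
  have E_eq: "?E N = (\<lambda>z. \<Prod>r=1..N. exp (ell r z))" for N
    by (simp add: fun_eq_iff exp_sum prod.atLeast1_atMost_eq)
  have hol: "?E N holomorphic_on ball 0 \<rho>" for N
    using \<rho> by (intro holomorphic_intros holomorphic_on_subset[OF holomorphic_ell]) auto
  have ulim: "uniform_limit (ball 0 \<rho>) ?E (\<lambda>z. exp (ell_sum z)) sequentially"
    using \<rho> \<rho>0 by (intro uniform_limit_exp_ell) auto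
  have hol': "(\<lambda>z. exp (ell_sum z)) holomorphic_on ball 0 \<rho>"
  proof (rule holomorphic_uniform_sequence[OF open_ball hol])
    fix x :: complex assume "x \<in> ball 0 \<rho>"
    then obtain d where "d > 0" "cball x d \<subseteq> ball 0 \<rho>"
      by (metis open_contains_cball open_ball)
    then show "\<exists>d>0. cball x d \<subseteq> ball 0 \<rho> \<and> uniform_limit (cball x d) ?E (\<lambda>z. exp (ell_sum z)) sequentially"
      using uniform_limit_on_subset[OF ulim] by blast
  qed
  have coeff: "(deriv ^^ n) (\<lambda>z. exp (ell_sum z)) 0 / fact n = gamma_comp \<phi> (stuffle_all 1) n" for n
  proof -
    have "(\<lambda>N. (deriv ^^ n) (?E N) 0) \<longlonglongrightarrow> (deriv ^^ n) (\<lambda>z. exp (ell_sum z)) 0"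
      using \<rho>0 hol by (intro higher_deriv_complex_uniform_limit[OF ulim]) auto
    then have "(\<lambda>N. (deriv ^^ n) (?E N) 0 / fact n) \<longlonglongrightarrow> (deriv ^^ n) (\<lambda>z. exp (ell_sum z)) 0 / fact n"
      by (intro tendsto_intros) auto
    moreover have "(deriv ^^ n) (?E N) 0 / fact n = (\<Prod>r=1..N. star_fps r) $ n" for N
    proof -
      have "?E N has_fps_expansion (\<Prod>r=1..N. star_fps r)"
        unfolding E_eq by (intro has_fps_expansion_prod exp_ell_has_fps_expansion) auto
      then show ?thesis by (simp only: fps_nth_fps_expansion)
    qed
    moreover have "(\<lambda>N. (\<Prod>r=1..N. star_fps r) $ n) \<longlonglongrightarrow> gamma_comp \<phi> (stuffle_all 1) n"
      using prod_star_fps_nth[of n]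
      by (intro tendsto_eventually) (auto simp: eventually_at_top_linorder)
    ultimately show ?thesis using LIMSEQ_unique by force
  qed
  have "(\<lambda>n. (deriv ^^ n) (\<lambda>z. exp (ell_sum z)) 0 / fact n * (z - 0) ^ n) sums exp (ell_sum z)"
    using \<rho> by (intro holomorphic_power_series[OF hol']) auto
  moreover have "gamma_comp \<phi> (stuffle_all z) = (\<lambda>n. gamma_comp \<phi> (stuffle_all 1) n * z ^ n)"
    by (rule ext) (rule gamma_comp_stuffle_all)
  ultimately show ?thesis by (simp add: coeff)
qed

end

section \<open>Iterated integrals and the infinite shuffle product\<close>

lemma sum_prod_list_words:
  fixes c :: "'a \<Rightarrow> 'b::comm_semiring_1"
  assumes "finite A"
  shows "(\<Sum>w | set w \<subseteq> A \<and> length w = n. prod_list (map c w)) = (\<Sum>k\<in>A. c k) ^ n"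
proof (induction n)
  case 0
  have "{w. set w \<subseteq> A \<and> length w = 0} = {[]}" by auto
  then show ?case by simp
next
  case (Suc n)
  have "(\<Sum>w | set w \<subseteq> A \<and> length w = Suc n. prod_list (map c w))
      = (\<Sum>(w, k)\<in>{w. set w \<subseteq> A \<and> length w = n} \<times> A. c k * prod_list (map c w))"
    by (subst lists_length_Suc_eq, subst sum.reindex) (auto simp: inj_on_def intro!: sum.cong)
  also have "\<dots> = (\<Sum>w | set w \<subseteq> A \<and> length w = n. prod_list (map c w)) * (\<Sum>k\<in>A. c k)"
    unfolding sum_product sum.cartesian_product[symmetric] by (intro sum.cong refl mult.commute)
  also have "\<dots> = (\<Sum>k\<in>A. c k) ^ Suc n"
    by (simp add: Suc.IH mult.commute)
  finally show ?case .
qed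

text \<open>An increasing exhaustion of \<open>Y_words\<close> by finite sets, which turns an
  unordered sum over words into the limit of a sequence. One \<open>N\<close> bounds letters and
  length, so the sums become truncated exponential series.\<close>

definition words_upto :: "nat \<Rightarrow> word set" where
  "words_upto N = {w. set w \<subseteq> {1..N} \<and> length w \<le> N}"

lemma finite_words_upto: "finite (words_upto N)"
  by (simp add: words_upto_def finite_lists_length_le)

lemma words_upto_subset: "words_upto N \<subseteq> Y_words"
  by (auto simp: words_upto_def Y_words_def)

lemma words_upto_exhaust: "filterlim words_upto (finite_subsets_at_top Y_words) sequentially"
proof (subst filterlim_finite_subsets_at_top, intro allI impI)
  fix X assume X: "finite X \<and> X \<subseteq> Y_words"
  obtain N where N: "\<And>w. w \<in> X \<Longrightarrow> length w + sum_list w \<le> N"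
    using X finite_nat_set_iff_bounded_le[of "(\<lambda>w. length w + sum_list w) ` X"] by auto
  have "X \<subseteq> words_upto M" if "M \<ge> N" for M
  proof
    fix w assume w: "w \<in> X"
    then have "0 \<notin> set w" using X by (auto simp: Y_words_def)
    then have "1 \<le> k \<and> k \<le> M" if "k \<in> set w" for k
      using that N[OF w] member_le_sum_list[OF that] \<open>M \<ge> N\<close> by (cases k) auto
    moreover have "length w \<le> M" using N[OF w] \<open>M \<ge> N\<close> by linarith
    ultimately show "w \<in> words_upto M" by (auto simp: words_upto_def)
  qed
  then show "\<forall>\<^sub>F N in sequentially. finite (words_upto N) \<and> X \<subseteq> words_upto N \<and> words_upto N \<subseteq> Y_words"
    using finite_words_upto words_upto_subset by (auto simp: eventually_at_top_linorder)
qed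

lemma sum_words_upto:
  fixes f :: "word \<Rightarrow> 'b::comm_monoid_add"
  shows "(\<Sum>w\<in>words_upto N. f w) = (\<Sum>n\<le>N. \<Sum>w | set w \<subseteq> {1..N} \<and> length w = n. f w)"
proof -
  have "(\<Sum>w\<in>words_upto N. f w) = (\<Sum>n\<le>N. \<Sum>w\<in>{w \<in> words_upto N. length w = n}. f w)"
    by (rule sum.group[symmetric]) (auto simp: finite_words_upto, auto simp: words_upto_def)
  also have "\<dots> = (\<Sum>n\<le>N. \<Sum>w | set w \<subseteq> {1..N} \<and> length w = n. f w)"
    by (intro sum.cong) (auto simp: words_upto_def)
  finally show ?thesis .
qed

lemma series_prod_shuffle_upto:
  "series_prod_upto shuffle (\<lambda>r. kleene_star (yterm 1 r)) N = star (\<lambda>k. if k \<in> {1..N} then 1 else 0)"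
proof (induction N)
  case (Suc N)
  show ?case
    unfolding series_prod_upto.simps Suc.IH
    unfolding yterm_eq_letter_series kleene_star_letter_series star_shuffle
    by (rule arg_cong[of _ _ star]) (auto simp: fun_eq_iff)
qed (simp add: one_series_eq_star)

lemma series_prod_shuffle_inf:
  "series_prod_inf shuffle (\<lambda>r. kleene_star (yterm 1 r)) w = (if w \<in> Y_words then 1 else 0)"
proof -
  have *: "star (\<lambda>k. if k \<in> {1..N} then 1 else 0) w = (if w \<in> Y_words then 1 else 0)"
    if "N \<ge> sum_list w" for N
  proof -
    have *: "k \<le> N" if "k \<in> set w" for k
      using member_le_sum_list[OF that] \<open>N \<ge> sum_list w\<close> by linarith
    have "star (\<lambda>k. if k \<in> {1..N} then 1 else 0) w = star (\<lambda>k. if k \<noteq> 0 then 1 else 0) w"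
      using * by (intro star_cong) auto
    also have "\<dots> = (if w \<in> Y_words then 1 else 0)"
      by (induction w) (auto simp: Y_words_def)
    finally show ?thesis .
  qed
  show ?thesis
    unfolding series_prod_inf_def series_prod_shuffle_upto
    by (intro limI tendsto_eventually eventually_sequentiallyI[of "sum_list w"] *)
qed

text \<open>The base and the cutoff both vary with \<open>N\<close>. Tannery's theorem applies with
  the majorant \<open>B ^ n / fact n\<close>, where \<open>B\<close> bounds the convergent sequence
  \<open>L\<close>.\<close>

lemma sum_power_div_fact_tendsto:
  fixes L :: "nat \<Rightarrow> complex"
  assumes "L \<longlonglongrightarrow> l"
  shows "(\<lambda>N. \<Sum>n\<le>N. L N ^ n / fact n) \<longlonglongrightarrow> exp l"
proof -
  obtain B where B: "\<And>N. norm (L N) \<le> B"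
    using convergent_imp_Bseq[of L] assms by (auto simp: Bseq_def convergent_def)
  have "B \<ge> 0" using B[of 0] norm_ge_zero order_trans by blast
  let ?a = "\<lambda>n N. if n \<le> N then L N ^ n / fact n else 0"
  have "(\<lambda>N. \<Sum>n. ?a n N) \<longlonglongrightarrow> (\<Sum>n. l ^ n / fact n)"
  proof (rule tannerys_theorem[THEN conjunct2, THEN conjunct2])
    fix n
    have "(\<lambda>N. L N ^ n / fact n) \<longlonglongrightarrow> l ^ n / fact n" by (intro tendsto_intros assms) simp
    then show "?a n \<longlonglongrightarrow> l ^ n / fact n"
      by (rule Lim_transform_eventually) (auto simp: eventually_at_top_linorder)
    show "summable (\<lambda>n. B ^ n / fact n)"
      using summable_exp[of B] by (simp add: divide_inverse mult.commute)
    have "norm (?a n N) \<le> B ^ n / fact n" for n N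
      using B[of N] \<open>B \<ge> 0\<close> by (auto simp: norm_divide norm_power intro!: divide_right_mono power_mono)
    then show "\<forall>\<^sub>F (n, N) in at_top \<times>\<^sub>F sequentially. norm (?a n N) \<le> B ^ n / fact n"
      by (intro always_eventually) auto
  qed simp
  moreover have "(\<Sum>n. ?a n N) = (\<Sum>n\<le>N. L N ^ n / fact n)" for N
    by (subst suminf_finite[of "{..N}"]) auto
  moreover have "(\<Sum>n. l ^ n / fact n) = exp l"
    by (simp add: exp_def divide_inverse scaleR_conv_of_real mult.commute)
  ultimately show ?thesis by simp
qed

section \<open>Analytic properties of the iterated integrals\<close>

declare alpha.simps(2) [simp del]

context stuffle_gamma
begin

lemma holomorphic_deriv_ell: "r \<ge> 1 \<Longrightarrow> deriv (ell r) holomorphic_on ball 0 1"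
  by (rule holomorphic_deriv[OF holomorphic_ell open_ball])

text \<open>A holomorphic integrand on the convex disc has a primitive \<open>g\<close>, and the
  integral along the segment is \<open>g z - g 0\<close>. Afterwards iterated integrals over
  nonempty words enter only through these two facts.\<close>

lemma alpha_Cons:
  assumes "i \<ge> 1" "alpha w holomorphic_on ball 0 1"
  shows "alpha (i # w) 0 = 0"
    and "z \<in> ball 0 1 \<Longrightarrow> (alpha (i # w) has_field_derivative deriv (ell i) z * alpha w z) (at z)"
proof -
  let ?f = "\<lambda>t. deriv (ell i) t * alpha w t"
  have "?f holomorphic_on ball 0 1"
    by (intro holomorphic_on_mult holomorphic_deriv_ell assms)
  then obtain g where g: "\<And>x. x \<in> ball 0 1 \<Longrightarrow> (g has_field_derivative ?f x) (at x within ball 0 1)"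
    using holomorphic_convex_primitive'[OF convex_ball open_ball] by blast
  have eq: "alpha (i # w) x = g x - g 0" if "x \<in> ball 0 1" for x
  proof -
    have "path_image (linepath 0 x) \<subseteq> ball 0 1"
      using that by (simp add: closed_segment_subset)
    from contour_integral_primitive[OF g valid_path_linepath this]
    show ?thesis by (simp add: alpha.simps(2) contour_integral_unique)
  qed
  show "alpha (i # w) 0 = 0" using eq[of 0] by simp
  show "(alpha (i # w) has_field_derivative ?f z) (at z)" if z: "z \<in> ball 0 1"
  proof -
    have "((\<lambda>x. g x - g 0) has_field_derivative ?f z - 0) (at z)"
      using g[OF z] z by (intro derivative_intros) (simp add: at_within_open[OF _ open_ball])
    then have "((\<lambda>x. g x - g 0) has_field_derivative ?f z) (at z)" by simp
    then show ?thesis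
      by (rule has_field_derivative_transform_within_open[OF _ open_ball z]) (simp add: eq)
  qed
qed

lemma holomorphic_alpha: "w \<in> Y_words \<Longrightarrow> alpha w holomorphic_on ball 0 1"
proof (induction w)
  case Nil
  have "alpha [] = (\<lambda>_. 1)" by (simp add: fun_eq_iff)
  then show ?case by simp
next
  case (Cons i w)
  then have "i \<ge> 1" "alpha w holomorphic_on ball 0 1" by (auto simp: Y_words_def)
  from alpha_Cons(2)[OF this] show ?case
    unfolding holomorphic_on_open[OF open_ball] by blast
qed

text \<open>Differentiation strips the first letter, and summing over it gives L' times the sum over
  words of length \<open>n\<close>, with L the sum of the \<open>ell r\<close>. By induction this is
  L' L^n / n!, the derivative of L^(n+1) / (n+1)!.\<close>

lemma sum_alpha:
  assumes "z \<in> ball 0 1"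
  shows "(\<Sum>w | set w \<subseteq> {1..N} \<and> length w = n. alpha w z) = (\<Sum>r<N. ell (Suc r) z) ^ n / fact n"
  using assms
proof (induction n arbitrary: z)
  case 0
  have "{w. set w \<subseteq> {1..N} \<and> length w = 0} = {[]}" by auto
  then show ?case by simp
next
  case (Suc n)
  let ?W = "{w. set w \<subseteq> {1..N} \<and> length w = n}" and ?L = "\<lambda>z. \<Sum>r<N. ell (Suc r) z"
  let ?A = "\<lambda>z. \<Sum>w\<in>?W. \<Sum>i\<in>{1..N}. alpha (i # w) z"
  let ?d = "\<lambda>z. \<Sum>i\<in>{1..N}. deriv (ell i) z"
  have A: "(\<Sum>w | set w \<subseteq> {1..N} \<and> length w = Suc n. alpha w z) = ?A z" for z
    by (subst lists_length_Suc_eq, subst sum.reindex)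
       (auto simp: inj_on_def sum.cartesian_product case_prod_unfold)
  have W: "alpha w holomorphic_on ball 0 1" if "w \<in> ?W" for w
    using that by (intro holomorphic_alpha) (auto simp: Y_words_def)
  have dA: "(?A has_field_derivative ?d x * (?L x ^ n / fact n)) (at x)" if x: "x \<in> ball 0 1" for x
  proof -
    have "(?A has_field_derivative (\<Sum>w\<in>?W. \<Sum>i\<in>{1..N}. deriv (ell i) x * alpha w x)) (at x)"
      using W x by (intro DERIV_sum alpha_Cons) auto
    also have "(\<Sum>w\<in>?W. \<Sum>i\<in>{1..N}. deriv (ell i) x * alpha w x) = ?d x * (?L x ^ n / fact n)"
      by (simp only: Suc.IH[OF x, symmetric] sum_product) (rule sum.swap)
    finally show ?thesis .
  qed
  have dL: "(?L has_field_derivative ?d x) (at x)" if x: "x \<in> ball 0 1" for x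
  proof -
    have "(?L has_field_derivative (\<Sum>r<N. deriv (ell (Suc r)) x)) (at x)"
      using x by (intro DERIV_sum holomorphic_derivI[OF holomorphic_ell open_ball]) auto
    also have "(\<Sum>r<N. deriv (ell (Suc r)) x) = ?d x"
      by (simp add: sum.atLeast1_atMost_eq)
    finally show ?thesis .
  qed
  have "((\<lambda>x. ?A x - ?L x ^ Suc n / fact (Suc n)) has_field_derivative 0) (at x within ball 0 1)"
    if x: "x \<in> ball 0 1" for x
  proof -
    have D: "((\<lambda>x. ?A x - ?L x ^ Suc n / fact (Suc n)) has_field_derivative
        ?d x * (?L x ^ n / fact n) - of_nat (Suc n) * (?d x * ?L x ^ (Suc n - Suc 0)) / fact (Suc n)) (at x)"
      by (rule DERIV_diff[OF dA[OF x] DERIV_cdivide[OF DERIV_power[OF dL[OF x]]]])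
    have eq: "of_nat (Suc n) * (?d x * ?L x ^ (Suc n - Suc 0)) / fact (Suc n) = ?d x * (?L x ^ n / fact n)"
      by (subst fact_Suc, subst mult_divide_mult_cancel_left) (simp_all del: of_nat_Suc)
    from D show ?thesis
      unfolding eq diff_self by (rule has_field_derivative_at_within)
  qed
  from has_field_derivative_zero_constant[OF convex_ball this]
  obtain c where c: "\<forall>x\<in>ball 0 1. ?A x - ?L x ^ Suc n / fact (Suc n) = c" by (rule exE)
  \<comment> \<open>The constant is determined at the origin, where the integrals and all
    \<open>ell r\<close> vanish.\<close>
  have "?A 0 = 0" using W by (intro sum.neutral ballI alpha_Cons(1)) auto
  then have "c = 0" using bspec[OF c, of 0] by simp
  then show ?case using bspec[OF c Suc.prems] unfolding A by simp
qed

text \<open>The factorial gained by iterated integration makes the sum over all words an exponential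
  series, which converges however large the sum of the \<open>M i\<close> may be.\<close>

lemma norm_alpha_le:
  assumes M: "\<And>i u. i \<ge> 1 \<Longrightarrow> norm u \<le> \<rho> \<Longrightarrow> norm (deriv (ell i) u) \<le> M i"
    and \<rho>: "0 \<le> \<rho>" "\<rho> < 1" and "w \<in> Y_words" "norm z \<le> \<rho>"
  shows "norm (alpha w z) \<le> prod_list (map M w) * norm z ^ length w / fact (length w)"
  using assms(4,5)
proof (induction w arbitrary: z)
  case (Cons i w)
  then have i: "i \<ge> 1" and w: "w \<in> Y_words" by (auto simp: Y_words_def)
  let ?n = "length w" and ?P = "prod_list (map M w)"
  let ?f = "\<lambda>t::real. alpha (i # w) (of_real t * z)"
  \<comment> \<open>Chosen with \<open>?g 0 = 0\<close>, with the claimed bound as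
    \<open>?g 1\<close>, and with a derivative equal to \<open>M i\<close> times the inductive bound
    at \<open>t z\<close> times |z|.\<close>
  let ?g = "\<lambda>t::real. M i * ?P * norm z ^ Suc ?n / fact (Suc ?n) * t ^ Suc ?n"
  have tz: "norm (of_real t * z) \<le> \<rho>" "of_real t * z \<in> ball 0 1" if "t \<in> {0..1}" for t :: real
  proof -
    have "norm (of_real t * z) \<le> 1 * norm z"
      unfolding norm_mult using that by (intro mult_right_mono) auto
    then show "norm (of_real t * z) \<le> \<rho>" using Cons.prems by simp
    then show "of_real t * z \<in> ball 0 1" using \<rho> by simp
  qed
  have df: "(?f has_vector_derivative deriv (ell i) (of_real t * z) * alpha w (of_real t * z) * z) (at t)"
    if "t \<in> {0..1}" for t
  proof -
    have "(alpha (i # w) has_field_derivative deriv (ell i) (of_real t * z) * alpha w (of_real t * z)) (at (of_real t * z))"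
      by (rule alpha_Cons(2)[OF i holomorphic_alpha[OF w] tz(2)[OF that]])
    moreover have "((\<lambda>t. of_real t * z) has_vector_derivative z) (at t)"
      by (auto intro!: derivative_eq_intros)
    ultimately show ?thesis
      using field_vector_diff_chain_at[of "\<lambda>t. of_real t * z" z t "alpha (i # w)"
          "deriv (ell i) (of_real t * z) * alpha w (of_real t * z)"]
      by (simp add: o_def mult_ac)
  qed
  have dg: "(?g has_vector_derivative M i * ?P * norm z ^ Suc ?n / fact ?n * t ^ ?n) (at t)" for t
  proof -
    have "(?g has_field_derivative M i * ?P * norm z ^ Suc ?n / fact (Suc ?n) * (of_nat (Suc ?n) * t ^ ?n)) (at t)"
      using DERIV_pow[of "Suc ?n" t] by (intro DERIV_cmult) simp
    moreover have "M i * ?P * norm z ^ Suc ?n / fact (Suc ?n) * (of_nat (Suc ?n) * t ^ ?n)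
        = M i * ?P * norm z ^ Suc ?n / fact ?n * t ^ ?n"
      by (simp add: divide_simps del: of_nat_Suc)
    ultimately show ?thesis by (simp only: has_real_derivative_iff_has_vector_derivative)
  qed
  have "norm (?f 1 - ?f 0) \<le> ?g 1 - ?g 0"
  proof (rule differentiable_bound_general[OF zero_less_one])
    show "continuous_on {0..1} ?f"
      by (rule continuous_on_vector_derivative) (use df has_vector_derivative_at_within in blast)
    show "continuous_on {0..1} ?g" by (intro continuous_intros)
    fix t :: real assume t: "0 < t" "t < 1"
    then have t': "t \<in> {0..1}" by simp
    show "(?f has_vector_derivative deriv (ell i) (of_real t * z) * alpha w (of_real t * z) * z) (at t)"
      by (rule df[OF t'])
    show "(?g has_vector_derivative M i * ?P * norm z ^ Suc ?n / fact ?n * t ^ ?n) (at t)" by (rule dg)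
    have Mi: "norm (deriv (ell i) (of_real t * z)) \<le> M i" by (rule M[OF i tz(1)[OF t']])
    then have "M i \<ge> 0" using norm_ge_zero order_trans by blast
    then have "norm (deriv (ell i) (of_real t * z)) * norm (alpha w (of_real t * z)) * norm z
        \<le> M i * (?P * norm (of_real t * z) ^ ?n / fact ?n) * norm z"
      using Cons.IH[OF w tz(1)[OF t']] Mi by (intro mult_right_mono mult_mono) auto
    then show "norm (deriv (ell i) (of_real t * z) * alpha w (of_real t * z) * z)
        \<le> M i * ?P * norm z ^ Suc ?n / fact ?n * t ^ ?n"
      using t by (simp add: norm_mult power_mult_distrib mult_ac)
  qed
  then show ?case using alpha_Cons(1)[OF i holomorphic_alpha[OF w]] by simp
qed simp

lemma deriv_ell_bound:
  assumes "0 \<le> \<rho>" "\<rho> < 1"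
  obtains M :: "nat \<Rightarrow> real" where "\<And>i u. i \<ge> 1 \<Longrightarrow> norm u \<le> \<rho> \<Longrightarrow> norm (deriv (ell i) u) \<le> M i"
    "summable M" "\<And>i. M i \<ge> 0"
proof -
  \<comment> \<open>Cauchy's inequality is applied on discs of radius
    \<open>\<sigma> - \<rho>\<close>, which stay in the disc of radius \<open>\<sigma>\<close>;
    there \<open>ell i\<close> is O(\<sigma>^i), and this makes the bounds summable in
    \<open>i\<close>.\<close>
  obtain \<sigma> where \<sigma>: "\<rho> < \<sigma>" "\<sigma> < 1" using assms(2) dense by blast
  let ?M = "\<lambda>i. letter_bound / (1 - \<sigma>) * \<sigma> ^ i / (\<sigma> - \<rho>)"
  show thesis
  proof (rule that[of ?M])
    fix i :: nat and u :: complex assume i: "i \<ge> 1" and u: "norm u \<le> \<rho>"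
    have le: "norm x \<le> \<sigma>" if "x \<in> cball u (\<sigma> - \<rho>)" for x
      using that u norm_triangle_ineq[of u "x - u"] by (simp add: dist_norm norm_minus_commute)
    have sub: "cball u (\<sigma> - \<rho>) \<subseteq> ball 0 1"
    proof
      fix x assume "x \<in> cball u (\<sigma> - \<rho>)"
      from le[OF this] show "x \<in> ball 0 1" using \<sigma> by simp
    qed
    have "norm ((deriv ^^ 1) (ell i) u) \<le> fact 1 * (letter_bound / (1 - \<sigma>) * \<sigma> ^ i) / (\<sigma> - \<rho>) ^ 1"
    proof (rule Cauchy_inequality)
      show "ell i holomorphic_on ball u (\<sigma> - \<rho>)"
        by (rule holomorphic_on_subset[OF holomorphic_ell[OF i]]) (use sub in auto)
      show "continuous_on (cball u (\<sigma> - \<rho>)) (ell i)"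
        by (rule holomorphic_on_imp_continuous_on[OF holomorphic_on_subset[OF holomorphic_ell[OF i] sub]])
      show "norm (ell i x) \<le> letter_bound / (1 - \<sigma>) * \<sigma> ^ i" if "norm (u - x) = \<sigma> - \<rho>" for x
        using that \<sigma> i by (intro norm_ell_le le) (auto simp: dist_norm)
    qed (use \<sigma> in auto)
    then show "norm (deriv (ell i) u) \<le> ?M i" by simp
  next
    show "summable ?M"
      using \<sigma> assms by (intro summable_divide summable_mult summable_geometric) auto
    show "?M i \<ge> 0" for i
      using \<sigma> assms letter_bound_nonneg by (intro divide_nonneg_nonneg mult_nonneg_nonneg) auto
  qed
qed

text \<open>An unordered sum over words requires absolute summability. Every finite partial sum of
  norms is bounded by exp(|z| times the sum of the \<open>M i\<close>).\<close>

lemma alpha_summable: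
  assumes "norm z < 1"
  shows "(\<lambda>w. alpha w z) summable_on Y_words"
proof (rule abs_summable_summable)
  obtain M :: "nat \<Rightarrow> real" where M: "\<And>i u. i \<ge> 1 \<Longrightarrow> norm u \<le> norm z \<Longrightarrow> norm (deriv (ell i) u) \<le> M i"
    "summable M" "\<And>i. M i \<ge> 0"
    by (rule deriv_ell_bound[of "norm z"]) (use assms in auto)
  let ?c = "\<lambda>i. M i * norm z"
  have bound: "(\<Sum>w\<in>X. norm (alpha w z)) \<le> exp (suminf M * norm z)" if X: "finite X" "X \<subseteq> Y_words" for X
  proof -
    have "eventually (\<lambda>N. finite (words_upto N) \<and> X \<subseteq> words_upto N \<and> words_upto N \<subseteq> Y_words) sequentially"
      using words_upto_exhaust X unfolding filterlim_finite_subsets_at_top by blast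
    then obtain N where N: "X \<subseteq> words_upto N"
      using eventually_happens'[OF sequentially_bot] by blast
    have "(\<Sum>w\<in>X. norm (alpha w z)) \<le> (\<Sum>w\<in>words_upto N. norm (alpha w z))"
      by (rule sum_mono2[OF finite_words_upto N]) auto
    also have "\<dots> \<le> (\<Sum>w\<in>words_upto N. prod_list (map ?c w) / fact (length w))"
    proof (rule sum_mono)
      fix w assume "w \<in> words_upto N"
      then have "norm (alpha w z) \<le> prod_list (map M w) * norm z ^ length w / fact (length w)"
        using assms words_upto_subset by (intro norm_alpha_le[OF M(1)]) auto
      also have "prod_list (map M w) * norm z ^ length w = prod_list (map ?c w)"
        by (induction w) simp_all
      finally show "norm (alpha w z) \<le> prod_list (map ?c w) / fact (length w)" .
    qed
    also have "\<dots> = (\<Sum>n\<le>N. (\<Sum>k\<in>{1..N}. ?c k) ^ n / fact n)"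
      unfolding sum_words_upto
      by (intro sum.cong refl) (simp add: sum_divide_distrib[symmetric] sum_prod_list_words)
    also have "\<dots> \<le> (\<Sum>n\<le>N. (suminf M * norm z) ^ n / fact n)"
    proof (intro sum_mono divide_right_mono power_mono)
      show "0 \<le> (\<Sum>k\<in>{1..N}. ?c k)"
        by (intro sum_nonneg mult_nonneg_nonneg M(3) norm_ge_zero)
      have "(\<Sum>k\<in>{1..N}. M k) \<le> suminf M"
        by (intro sum_le_suminf M) auto
      then show "(\<Sum>k\<in>{1..N}. ?c k) \<le> suminf M * norm z"
        by (simp add: sum_distrib_right[symmetric] mult_right_mono)
    qed simp
    also have "\<dots> \<le> exp (suminf M * norm z)"
    proof -
      have pos: "suminf M * norm z \<ge> 0"
        by (intro mult_nonneg_nonneg suminf_nonneg M norm_ge_zero)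
      have exp: "(\<lambda>n. (suminf M * norm z) ^ n / fact n) sums exp (suminf M * norm z)"
        using exp_converges[of "suminf M * norm z"] by (simp add: divide_inverse mult.commute)
      show ?thesis
        unfolding sums_unique[OF exp] using pos
        by (intro sum_le_suminf sums_summable[OF exp]) auto
    qed
    finally show ?thesis .
  qed
  show "(\<lambda>w. norm (alpha w z)) summable_on Y_words"
    by (rule nonneg_bdd_above_summable_on, simp, rule bdd_aboveI2, rule bound) auto
qed

lemma infsum_alpha:
  assumes "norm z < 1"
  shows "(\<Sum>\<^sub>\<infinity>w\<in>Y_words. alpha w z) = exp (ell_sum z)"
proof -
  have "((\<lambda>X. \<Sum>w\<in>X. alpha w z) \<longlongrightarrow> (\<Sum>\<^sub>\<infinity>w\<in>Y_words. alpha w z)) (finite_subsets_at_top Y_words)"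
    using has_sum_infsum[OF alpha_summable[OF assms]] by (simp add: has_sum_def)
  from filterlim_compose[OF this words_upto_exhaust]
  have "(\<lambda>N. \<Sum>n\<le>N. (\<Sum>r<N. ell (Suc r) z) ^ n / fact n) \<longlonglongrightarrow> (\<Sum>\<^sub>\<infinity>w\<in>Y_words. alpha w z)"
    using assms by (simp only: sum_words_upto sum_alpha mem_ball_0)
  moreover have "(\<lambda>N. \<Sum>n\<le>N. (\<Sum>r<N. ell (Suc r) z) ^ n / fact n) \<longlonglongrightarrow> exp (ell_sum z)"
    unfolding ell_sum_def
    by (intro sum_power_div_fact_tendsto summable_LIMSEQ summable_norm_cancel[OF summable_ell[OF assms]])
  ultimately show ?thesis by (rule LIMSEQ_unique)
qed

end

section \<open>Cauchy products of convergent series\<close>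

text \<open>Abel's theorem along a sequence tending to 1 from below. Summation by parts expresses
  F(x) - s as (1 - x) times the power series of the deviations \<open>d n\<close> of the partial
  sums, which tend to 0.\<close>

lemma Abel_limit:
  fixes a :: "nat \<Rightarrow> complex" and x :: "nat \<Rightarrow> real"
  assumes a: "a sums s" and x: "\<And>k. 0 < x k \<and> x k < 1" and lim: "x \<longlonglongrightarrow> 1"
  shows "summable (\<lambda>n. norm (a n * of_real (x k) ^ n))"
    and "(\<lambda>k. \<Sum>n. a n * of_real (x k) ^ n) \<longlonglongrightarrow> s"
proof -
  obtain M where M: "\<And>n. norm (a n) \<le> M"
    using convergent_imp_Bseq[OF convergentI[OF summable_LIMSEQ_zero[OF sums_summable[OF a]]]]
    by (auto simp: Bseq_def)
  have norm: "summable (\<lambda>n. norm (a n * of_real (x k) ^ n))" for k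
  proof -
    have "summable (\<lambda>n. norm (a n) * x k ^ n)"
      using x[of k] M by (intro Abel_lemma[of "x k" 1 a M]) auto
    then show ?thesis using x[of k] by (simp add: norm_mult norm_power)
  qed
  then show "summable (\<lambda>n. norm (a n * of_real (x k) ^ n))" .
  define d where "d n = (\<Sum>i\<le>n. a i) - s" for n
  have "(\<lambda>n. \<Sum>i\<le>n. a i) \<longlonglongrightarrow> s" using a by (simp add: sums_def_le)
  then have d: "d \<longlonglongrightarrow> 0" unfolding d_def by (rule LIM_zero)
  then obtain D where D: "\<And>n. norm (d n) \<le> D"
    using convergent_imp_Bseq[OF convergentI[OF d]] by (auto simp: Bseq_def)
  have D0: "D \<ge> 0" using D[of 0] norm_ge_zero order_trans by blast
  \<comment> \<open>Multiplying by the geometric series turns coefficients into partial sums;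
    subtracting \<open>s\<close> times the geometric series leaves the deviations.\<close>
  have eq: "(\<lambda>n. d n * of_real (x k) ^ n) sums (((\<Sum>n. a n * of_real (x k) ^ n) - s) / (1 - of_real (x k)))" for k
  proof -
    let ?y = "of_real (x k) :: complex"
    have y: "norm ?y < 1" using x[of k] by simp
    have "(\<lambda>n. \<Sum>i\<le>n. a i * ?y ^ i * ?y ^ (n - i)) sums ((\<Sum>n. a n * ?y ^ n) * (\<Sum>n. ?y ^ n))"
      using y by (intro Cauchy_product_sums norm) (simp add: norm_power summable_geometric)
    moreover have "(\<Sum>i\<le>n. a i * ?y ^ i * ?y ^ (n - i)) = (\<Sum>i\<le>n. a i) * ?y ^ n" for n
      unfolding sum_distrib_right by (intro sum.cong refl) (simp add: mult.assoc flip: power_add)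
    ultimately have "(\<lambda>n. (\<Sum>i\<le>n. a i) * ?y ^ n - s * ?y ^ n) sums
        ((\<Sum>n. a n * ?y ^ n) * (1 / (1 - ?y)) - s * (1 / (1 - ?y)))"
      using geometric_sums[OF y] by (intro sums_diff sums_mult) (simp_all add: sums_iff)
    then show ?thesis by (simp add: d_def algebra_simps diff_divide_distrib)
  qed
  have "(\<lambda>k. (\<Sum>n. a n * of_real (x k) ^ n) - s) \<longlonglongrightarrow> 0"
  proof (rule LIMSEQ_I)
    fix e :: real assume e: "e > 0"
    obtain N where N: "\<And>n. n \<ge> N \<Longrightarrow> norm (d n) < e / 2"
      using LIMSEQ_D[OF d, of "e / 2"] e by auto
    \<comment> \<open>The first \<open>N\<close> deviations contribute at most (1 - x) N D, which
      becomes small as x tends to 1; all later ones together contribute at most e/2.\<close>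
    have "(\<lambda>k. (1 - x k) * (real N * D)) \<longlonglongrightarrow> (1 - 1) * (real N * D)"
      by (intro tendsto_intros lim)
    then obtain K where K: "\<And>k. k \<ge> K \<Longrightarrow> \<bar>(1 - x k) * (real N * D)\<bar> < e / 2"
      using LIMSEQ_D[of _ 0 "e / 2"] e by fastforce
    have "norm ((\<Sum>n. a n * of_real (x k) ^ n) - s - 0) < e" if "k \<ge> K" for k
    proof -
      let ?F = "\<Sum>n. a n * of_real (x k) ^ n"
      have xk: "0 < x k" "x k < 1" using x[of k] by auto
      have "(\<lambda>n. if n \<in> {..<N} then D else 0) sums (\<Sum>n<N. D)"
        by (rule sums_If_finite_set) simp
      moreover have "(\<lambda>n. e / 2 * x k ^ n) sums (e / 2 * (1 / (1 - x k)))"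
        using xk by (intro sums_mult geometric_sums) simp
      ultimately have g: "(\<lambda>n. (if n \<in> {..<N} then D else 0) + e / 2 * x k ^ n) sums
          ((\<Sum>n<N. D) + e / 2 * (1 / (1 - x k)))"
        by (rule sums_add)
      have "norm ((?F - s) / (1 - of_real (x k))) \<le> (\<Sum>n<N. D) + e / 2 * (1 / (1 - x k))"
      proof (rule norm_sums_le[OF eq g])
        fix n
        show "norm (d n * of_real (x k) ^ n) \<le> (if n \<in> {..<N} then D else 0) + e / 2 * x k ^ n"
        proof (cases "n < N")
          case True
          have "norm (d n) * x k ^ n \<le> D * 1"
            using xk D D0 by (intro mult_mono power_le_one) auto
          moreover have "0 \<le> e / 2 * x k ^ n" using e xk by simp
          ultimately show ?thesis using True xk by (simp add: norm_mult norm_power)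
        next
          case False
          then have "norm (d n) * x k ^ n \<le> e / 2 * x k ^ n"
            using N[of n] xk by (intro mult_right_mono) auto
          then show ?thesis using False xk by (simp add: norm_mult norm_power)
        qed
      qed
      moreover have "norm (1 - of_real (x k) :: complex) = 1 - x k"
        using xk by (metis norm_of_real abs_of_pos diff_gt_0_iff_gt of_real_1 of_real_diff)
      ultimately have "norm (?F - s) / (1 - x k) \<le> real N * D + e / 2 * (1 / (1 - x k))"
        by (simp add: norm_divide)
      then have "norm (?F - s) \<le> (real N * D + e / 2 * (1 / (1 - x k))) * (1 - x k)"
        using xk by (simp only: pos_divide_le_eq diff_gt_0_iff_gt)
      also have "\<dots> = (1 - x k) * (real N * D) + e / 2"
        using xk by (simp add: field_simps)
      finally have "norm (?F - s) \<le> (1 - x k) * (real N * D) + e / 2" .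
      then show ?thesis using K[OF that] unfolding diff_0_right by linarith
    qed
    then show "\<exists>K. \<forall>k\<ge>K. norm ((\<Sum>n. a n * of_real (x k) ^ n) - s - 0) < e" by blast
  qed
  then show "(\<lambda>k. \<Sum>n. a n * of_real (x k) ^ n) \<longlonglongrightarrow> s" by (rule LIM_zero_cancel)
qed

text \<open>Inside the unit interval all power series involved converge absolutely and may be
  multiplied. Abel's theorem, applied to all three series, carries the identity to the
  boundary.\<close>

lemma sums_Cauchy_product_unique:
  fixes a b :: "nat \<Rightarrow> complex"
  assumes a: "a sums s" and b: "b sums t" and c: "(\<lambda>n. \<Sum>i\<le>n. a i * b (n - i)) sums u"
  shows "u = s * t"
proof -
  \<comment> \<open>Any sequence in (0,1) tending to 1 would do; the shift by 2 keeps
    \<open>x 0\<close> positive.\<close>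
  define x :: "nat \<Rightarrow> real" where "x k = 1 - 1 / real (k + 2)" for k
  have x: "0 < x k \<and> x k < 1" for k by (simp add: x_def field_simps)
  have lim: "x \<longlonglongrightarrow> 1"
    using tendsto_diff[OF tendsto_const[of 1] LIMSEQ_ignore_initial_segment[OF lim_1_over_n, of 2]] by (simp add: x_def[abs_def])
  have "(\<Sum>n. (\<Sum>i\<le>n. a i * b (n - i)) * of_real (x k) ^ n)
      = (\<Sum>n. a n * of_real (x k) ^ n) * (\<Sum>n. b n * of_real (x k) ^ n)" for k
  proof -
    have "(\<Sum>i\<le>n. a i * b (n - i)) * of_real (x k) ^ n
        = (\<Sum>i\<le>n. a i * of_real (x k) ^ i * (b (n - i) * of_real (x k) ^ (n - i)))" for n
      unfolding sum_distrib_right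
      by (intro sum.cong refl) (simp add: mult_ac flip: power_add)
    then show ?thesis
      using Cauchy_product[OF Abel_limit(1)[OF a x lim] Abel_limit(1)[OF b x lim], of k k] by simp
  qed
  then have "(\<lambda>k. (\<Sum>n. a n * of_real (x k) ^ n) * (\<Sum>n. b n * of_real (x k) ^ n)) \<longlonglongrightarrow> u"
    using Abel_limit(2)[OF c x lim] by simp
  moreover have "(\<lambda>k. (\<Sum>n. a n * of_real (x k) ^ n) * (\<Sum>n. b n * of_real (x k) ^ n)) \<longlonglongrightarrow> s * t"
    by (intro tendsto_mult Abel_limit(2)[OF a x lim] Abel_limit(2)[OF b x lim])
  ultimately show ?thesis by (rule LIMSEQ_unique)
qed

lemma kleene_star_sum_stuffle:
  "kleene_star (series_sum {1..} (\<lambda>s. yterm (a s + b s) s)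
     + series_sum ({1..} \<times> {1..}) (\<lambda>(r, s). yterm (a s * b r) (s + r)))
   = series_prod stuffle (kleene_star (series_sum {1..} (\<lambda>s. yterm (a s) s)))
       (kleene_star (series_sum {1..} (\<lambda>s. yterm (b s) s)))"
proof -
  \<comment> \<open>The end terms \<open>i = 0\<close> and \<open>i = k\<close> drop out because the
    letter 0 has coefficient 0.\<close>
  have "(\<Sum>i\<le>k. (if i \<ge> 1 then a i else 0) * (if k - i \<ge> 1 then b (k - i) else 0))
      = (\<Sum>i\<in>{1..<k}. a i * b (k - i))" for k
    by (intro sum.mono_neutral_cong_right) auto
  then show ?thesis
    unfolding series_sum_yterm series_sum_yterm_pairs letter_series_add kleene_star_letter_series star_stuffle
    by (intro arg_cong[of _ _ star]) (auto simp: fun_eq_iff)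
qed

lemma Y_supported_kleene_star_sum:
  "Y_supported (kleene_star (series_sum {1..} (\<lambda>s. yterm (a s) s)))"
  unfolding series_sum_yterm kleene_star_letter_series by (rule Y_supported_star) simp

context stuffle_gamma
begin

text \<open>For general families only convergence of the three weight series is given, so Abel's
  argument replaces absolute convergence.\<close>

lemma gamma_ext_mult_conditional:
  assumes "Y_supported S" "Y_supported T"
    and "gamma_dom \<phi> (series_prod stuffle S T)" "gamma_dom \<phi> S" "gamma_dom \<phi> T"
  shows "gamma_ext \<phi> (series_prod stuffle S T) = gamma_ext \<phi> S * gamma_ext \<phi> T"
proof -
  have "gamma_comp \<phi> (series_prod stuffle S T)
      = (\<lambda>n. \<Sum>i\<le>n. gamma_comp \<phi> S i * gamma_comp \<phi> T (n - i))"
    by (rule ext) (rule gamma_comp_stuffle[OF character_mult assms(1,2)])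
  then have "(\<lambda>n. \<Sum>i\<le>n. gamma_comp \<phi> S i * gamma_comp \<phi> T (n - i)) sums gamma_ext \<phi> (series_prod stuffle S T)"
    using assms(3) by (simp add: gamma_dom_def gamma_ext_def summable_sums)
  moreover have "gamma_comp \<phi> S sums gamma_ext \<phi> S" "gamma_comp \<phi> T sums gamma_ext \<phi> T"
    using assms(4,5) by (simp_all add: gamma_dom_def gamma_ext_def summable_sums)
  ultimately show ?thesis using sums_Cauchy_product_unique by simp
qed

end

theorem corollary2p24:
  fixes \<phi> :: "word \<Rightarrow> complex"
  assumes gamma: "gamma_character \<phi>"
  shows
    "(\<forall>z. cmod z < 1 \<longrightarrow>
        gamma_dom \<phi> (series_prod_inf stuffle (\<lambda>r. kleene_star (yterm (z ^ r) r))) \<and>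
        (\<forall>r\<ge>1. gamma_dom \<phi> (kleene_star (yterm (z ^ r) r))) \<and>
        convergent_prod (\<lambda>r. gamma_ext \<phi> (kleene_star (yterm (z ^ Suc r) (Suc r)))) \<and>
        convergent_prod (\<lambda>r. exp (ell (Suc r) z)) \<and>
        convergent_prod (\<lambda>r. 1 / Gamma_Y (Suc r) (1 + z)) \<and>
        alpha_dom z (series_prod_inf shuffle (\<lambda>r. kleene_star (yterm 1 r))) \<and>
        gamma_ext \<phi> (series_prod_inf stuffle (\<lambda>r. kleene_star (yterm (z ^ r) r)))
          = (\<Prod>r. gamma_ext \<phi> (kleene_star (yterm (z ^ Suc r) (Suc r)))) \<and>
        (\<Prod>r. gamma_ext \<phi> (kleene_star (yterm (z ^ Suc r) (Suc r))))
          = (\<Prod>r. exp (ell (Suc r) z)) \<and>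
        (\<Prod>r. exp (ell (Suc r) z)) = (\<Prod>r. 1 / Gamma_Y (Suc r) (1 + z)) \<and>
        (\<Prod>r. 1 / Gamma_Y (Suc r) (1 + z))
          = alpha_ext z (series_prod_inf shuffle (\<lambda>r. kleene_star (yterm 1 r)))) \<and>
     (\<forall>a b :: nat \<Rightarrow> complex.
        (\<forall>s\<ge>1. cmod (a s) < 1 \<and> cmod (b s) < 1 \<and> cmod (a s + b s) < 1) \<longrightarrow>
        gamma_dom \<phi> (kleene_star (series_sum {1..} (\<lambda>s. yterm (a s + b s) s)
            + series_sum ({1..} \<times> {1..}) (\<lambda>(r, s). yterm (a s * b r) (s + r)))) \<longrightarrow>
        gamma_dom \<phi> (kleene_star (series_sum {1..} (\<lambda>s. yterm (a s) s))) \<longrightarrow>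
        gamma_dom \<phi> (kleene_star (series_sum {1..} (\<lambda>s. yterm (b s) s))) \<longrightarrow>
        gamma_ext \<phi> (kleene_star (series_sum {1..} (\<lambda>s. yterm (a s + b s) s)
            + series_sum ({1..} \<times> {1..}) (\<lambda>(r, s). yterm (a s * b r) (s + r))))
          = gamma_ext \<phi> (kleene_star (series_sum {1..} (\<lambda>s. yterm (a s) s)))
            * gamma_ext \<phi> (kleene_star (series_sum {1..} (\<lambda>s. yterm (b s) s)))) \<and>
     (\<forall>(a :: nat \<Rightarrow> complex) r s. (\<forall>k\<ge>1. cmod (a k) < 1) \<longrightarrow> r \<ge> 1 \<longrightarrow> s \<ge> 1 \<longrightarrow>
        gamma_dom \<phi> (kleene_star (yterm (a s) s)) \<and>
        gamma_dom \<phi> (kleene_star (yterm (a r) r)) \<and>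
        gamma_dom \<phi> (kleene_star (yterm (- a s) s)) \<and>
        gamma_dom \<phi> (kleene_star (yterm (a s) s + yterm (a r) r + yterm (a s * a r) (s + r))) \<and>
        gamma_dom \<phi> (kleene_star (yterm (- (a s ^ 2)) (2 * s))) \<and>
        gamma_ext \<phi> (kleene_star (yterm (a s) s + yterm (a r) r + yterm (a s * a r) (s + r)))
          = gamma_ext \<phi> (kleene_star (yterm (a s) s)) * gamma_ext \<phi> (kleene_star (yterm (a r) r)) \<and>
        gamma_ext \<phi> (kleene_star (yterm (- (a s ^ 2)) (2 * s)))
          = gamma_ext \<phi> (kleene_star (yterm (a s) s)) * gamma_ext \<phi> (kleene_star (yterm (- a s) s)))"
proof -
  interpret stuffle_gamma \<phi> by standard (rule gamma)
  show ?thesis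
  proof (intro conjI, goal_cases)
    case 1
    show ?case
    proof (intro allI impI, goal_cases)
      case (1 z)
      \<comment> \<open>Every member of the chain of equalities is evaluated to
        \<open>exp (ell_sum z)\<close>.\<close>
      have stuffle: "series_prod_inf stuffle (\<lambda>r. kleene_star (yterm (z ^ r) r)) = stuffle_all z"
        by (simp add: stuffle_all_def kleene_star_yterm)
      note all = gamma_stuffle_all_sums[OF 1]
      have dom: "gamma_dom \<phi> (kleene_star (yterm (z ^ r) r))"
        and ext: "gamma_ext \<phi> (kleene_star (yterm (z ^ r) r)) = exp (ell r z)" if "r \<ge> 1" for r
        using gamma_single_star_ell[OF that 1]
        by (simp_all add: gamma_dom_def gamma_ext_def kleene_star_yterm sums_iff)
      have ext_Suc: "gamma_ext \<phi> (kleene_star (yterm (z ^ Suc r) (Suc r))) = exp (ell (Suc r) z)" for r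
        by (rule ext) simp
      have Gamma: "1 / Gamma_Y r (1 + z) = exp (ell r z)" for r
        by (simp add: Gamma_Y_def exp_minus divide_inverse)
      have sum: "summable (\<lambda>r. ell (Suc r) z)"
        by (rule summable_norm_cancel[OF summable_ell[OF 1]])
      have prod: "(\<Prod>r. exp (ell (Suc r) z)) = exp (ell_sum z)"
        by (simp add: prodinf_exp[OF sum] ell_sum_def)
      have shuffle: "series_prod_inf shuffle (\<lambda>r. kleene_star (yterm 1 r)) w * alpha w z = alpha w z"
        if "w \<in> Y_words" for w
        using that by (simp add: series_prod_shuffle_inf)
      have alpha_dom: "alpha_dom z (series_prod_inf shuffle (\<lambda>r. kleene_star (yterm 1 r)))"
        unfolding alpha_dom_def by (rule iffD2[OF summable_on_cong alpha_summable[OF 1]]) (rule shuffle)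
      have alpha_ext: "alpha_ext z (series_prod_inf shuffle (\<lambda>r. kleene_star (yterm 1 r))) = exp (ell_sum z)"
        unfolding alpha_ext_def infsum_alpha[OF 1, symmetric] by (rule infsum_cong) (rule shuffle)
      have all_dom: "gamma_dom \<phi> (stuffle_all z)" and all_ext: "gamma_ext \<phi> (stuffle_all z) = exp (ell_sum z)"
        using all by (simp_all add: gamma_dom_def gamma_ext_def sums_iff)
      show ?case
        unfolding stuffle ext_Suc Gamma prod alpha_ext all_ext
        by (intro conjI allI impI refl dom all_dom alpha_dom convergent_prod_exp[OF sum])
    qed
  next
    case 2
    show ?case
      unfolding kleene_star_sum_stuffle
      by (intro allI impI gamma_ext_mult_conditional Y_supported_kleene_star_sum)
  next
    case 3
    show ?case
    proof (intro allI impI, goal_cases)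
      case (1 a r s)
      then have r: "r \<ge> 1" "norm (a r) < 1" and s: "s \<ge> 1" "norm (a s) < 1" "norm (- a s) < 1"
        by auto
      \<comment> \<open>Stars of single letters have absolutely convergent weight series, so the
        products and their membership in the domain are obtained together.\<close>
      note comp = gamma_comp_single_star_sums(2)
      note prod = gamma_ext_mult[OF Y_supported_single_star[OF s(1)] comp[OF s(1,2)]]
      note P = prod[OF Y_supported_single_star[OF r(1)] comp[OF r],
          unfolded single_star_stuffle[OF r(1) s(1)], folded kleene_star_yterm]
      note Q = prod[OF Y_supported_single_star[OF s(1)] comp[OF s(1,3)],
          unfolded single_star_stuffle_opposite[OF s(1)], folded kleene_star_yterm]
      show ?case
        by (intro conjI P Q gamma_dom_single_star r s)
    qed
  qed
qed

end
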